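(* Let $\lambda>1/2$ and let $f_\lambda(x)=\sum_{m=1}^\infty\frac{\sin 2\pi mx}{m^\lambda}$. Suppose that $(n_k)_{k\ge1}$ is a sequence of positive integers that is lacunary in the sense of Hadamard, and let $(a_k)_{k\ge1}$ be a sequence of complex numbers. Then the series $\sum_{k=1}^\infty a_kf_\lambda(n_kx)$ converges for Lebesgue-almost every $x$ if and only if $\sum_{k=1}^\infty|a_k|^2<\infty$.
   Context: The series defining the ($1$-periodic) Davenport function $f_\lambda$ converges at every $x\in\mathbb R$. A sequence of positive integers $(n_k)$ is lacunary in the sense of Hadamard if there is $q>1$ with $\inf_k n_{k+1}/n_k\ge q$. *)

theory Defs
  imports "HOL-Analysis.Analysis"
begin

text \<open>The index is shifted so that \<open>m = 0\<close> gives the first term of the series over \<open>m \<ge> 1\<close>.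
  For \<open>lam \<le> 1\<close> the convergence is only conditional in general; \<open>suminf\<close> is the limit of the
  partial sums taken in the natural order.\<close>

definition davenport :: "real \<Rightarrow> real \<Rightarrow> real" where
  "davenport lam x = (\<Sum>m. sin (2 * pi * real (Suc m) * x) / real (Suc m) powr lam)"

definition hadamard_lacunary :: "(nat \<Rightarrow> nat) \<Rightarrow> bool" where
  "hadamard_lacunary n \<longleftrightarrow> (\<exists>q::real. q > 1 \<and> (INF k. real (n (Suc k)) / real (n k)) \<ge> q)"

text \<open>The ratios are bounded below by 0, so the infimum is a genuine one.\<close>

lemma hadamard_lacunary_iff:
  "hadamard_lacunary n \<longleftrightarrow> (\<exists>q::real. q > 1 \<and> (\<forall>k. real (n (Suc k)) / real (n k) \<ge> q))"
proof -
  have "bdd_below (range (\<lambda>k. real (n (Suc k)) / real (n k)))"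
    by (rule bdd_belowI2[where m = 0]) simp
  then show ?thesis
    by (simp add: hadamard_lacunary_def le_cINF_iff)
qed

end

theory Submission
  imports Defs
begin

text \<open>Write \<open>f\<close> for the Davenport function, \<open>F k x = f (n k * x)\<close>, and \<open>q > 1\<close> for the lacunarity ratio.
Since \<open>f\<close> is real valued, the real and imaginary parts of the coefficients can be treated separately,
so the coefficients are real from now on. As \<open>lam > 1 / 2\<close>, the function \<open>f\<close> is locally square integrable
and its sine coefficients are explicit (\<open>davenport_sine_coefficient\<close>). They give
\<open>\<bar>\<integral> F j * F k\<bar> \<le> C * decay lam ^ \<bar>j - k\<bar>\<close>, hence, by Schur's test, an upper bound of the \<open>L\<^sup>2\<close> norm of
\<open>\<Sum> a k * F k\<close> by the \<open>\<ell>\<^sup>2\<close> norm of the coefficients (\<open>riesz_upper\<close>).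

Square summability implies convergence. The partial sums \<open>s N\<close> converge in \<open>L\<^sup>2\<close> to some \<open>S\<close>. The average
of \<open>S\<close> over the interval of radius \<open>1 / n N\<close> around \<open>x\<close> tends to \<open>S x\<close> for almost every \<open>x\<close> by Lebesgue's
differentiation theorem, so it suffices to compare this average with \<open>s N x\<close>. Averaging at scale
\<open>1 / n N\<close> hardly changes \<open>F k\<close> for \<open>k\<close> much smaller than \<open>N\<close> and nearly kills \<open>F k\<close> for \<open>k\<close> much larger than
\<open>N\<close>: both errors have \<open>L\<^sup>2\<close> norm at most a constant times \<open>r ^ \<bar>N - k\<bar>\<close> with \<open>r < 1\<close>, because the average
acts on \<open>sin (2 * pi * \<nu> * x)\<close> by a sinc multiplier (\<open>truncation_error_sqint\<close>). Hence the squared \<open>L\<^sup>2\<close> norms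
of the differences are summable over \<open>N\<close>, and the differences tend to \<open>0\<close> almost everywhere
(\<open>AE_convergent_of_square_summable\<close>).

Convergence implies square summability. On a set whose complement \<open>U\<close> in \<open>[-1, 1]\<close> is as small as desired,
the partial sums are bounded by a constant \<open>m\<close>. They are tested against a sine polynomial \<open>G\<close>, built from
the same coefficients, that nearly inverts the map from coefficients to sums. Formally, the inverse of
multiplication by the Dirichlet series \<open>\<Sum> m powr (- lam - w)\<close> is given by the Moebius function;
keeping only the divisors composed of primes up to \<open>D\<close> leaves the diagonal and ratios \<open>n j / n k > D\<close>, which
contribute little (\<open>exists_dual_primes\<close>). Thus \<open>\<integral> s N * G \<ge> (1 / 2) * \<Sum> (a k)\<^sup>2\<close>. The polynomial \<open>G\<close> is a
fixed number of lacunary sine polynomials, whose \<open>L\<^sup>4\<close> norms are bounded by their \<open>L\<^sup>2\<close> norms; so the part of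
the integral over \<open>U\<close> is a small multiple of \<open>\<Sum> (a k)\<^sup>2\<close>, while the rest is at most a constant times
\<open>m * sqrt (\<Sum> (a k)\<^sup>2)\<close>. This bounds \<open>\<Sum> (a k)\<^sup>2\<close> independently of \<open>N\<close>
(\<open>square_summable_of_AE_convergent\<close>). That \<open>s N\<close> itself need not be in \<open>L\<^sup>4\<close> when \<open>lam\<close> is close
to \<open>1 / 2\<close> is the reason for putting the fourth moment on \<open>G\<close>.\<close>

section \<open>Schur bounds for geometrically decaying kernels\<close>

definition gap :: "nat \<Rightarrow> nat \<Rightarrow> nat" where
  "gap j k = (j - k) + (k - j)"

lemma gap_commute: "gap j k = gap k j"
  by (simp add: gap_def)

lemma gap_self [simp]: "gap k k = 0"
  by (simp add: gap_def)

lemma sum_power_gap_le: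
  fixes r :: real
  assumes r: "0 < r" "r < 1" and K: "finite K"
  shows "(\<Sum>k\<in>K. r ^ gap j k) \<le> 2 / (1 - r)"
proof -
  have geo: "(\<Sum>k\<in>A. r ^ g k) \<le> 1 / (1 - r)" if "finite A" "inj_on g A" for A and g :: "nat \<Rightarrow> nat"
  proof -
    have "(\<Sum>k\<in>A. r ^ g k) = (\<Sum>i\<in>g ` A. r ^ i)"
      using that by (simp add: sum.reindex)
    also have "\<dots> \<le> (\<Sum>i. r ^ i)"
      using that r by (intro sum_le_suminf) (auto intro: summable_geometric)
    also have "\<dots> = 1 / (1 - r)"
      using r by (simp add: suminf_geometric)
    finally show ?thesis .
  qed
  have "(\<Sum>k\<in>K. r ^ gap j k) = (\<Sum>k\<in>{k\<in>K. k \<le> j}. r ^ gap j k) + (\<Sum>k\<in>{k\<in>K. \<not> k \<le> j}. r ^ gap j k)"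
    using K by (subst sum.union_disjoint [symmetric]) (auto intro: sum.cong)
  also have "\<dots> = (\<Sum>k\<in>{k\<in>K. k \<le> j}. r ^ (j - k)) + (\<Sum>k\<in>{k\<in>K. \<not> k \<le> j}. r ^ (k - j))"
    by (intro arg_cong2[where f = "(+)"] sum.cong) (auto simp: gap_def)
  also have "\<dots> \<le> 1 / (1 - r) + 1 / (1 - r)"
    using K by (intro add_mono geo) (auto simp: inj_on_def)
  finally show ?thesis by simp
qed

text \<open>Schur's test. The kernel \<open>r ^ \<bar>j - k\<bar>\<close> has uniformly bounded row sums, so after
\<open>2 * \<bar>c j * c k\<bar> \<le> (c j)\<^sup>2 + (c k)\<^sup>2\<close> only row sums remain.\<close>

lemma schur_gap:
  fixes c :: "nat \<Rightarrow> real"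
  assumes r: "0 < r" "r < 1" and K: "finite K"
  shows "(\<Sum>j\<in>K. \<Sum>k\<in>K. \<bar>c j\<bar> * \<bar>c k\<bar> * r ^ gap j k) \<le> 2 / (1 - r) * (\<Sum>k\<in>K. (c k)\<^sup>2)"
proof -
  have "(\<Sum>j\<in>K. \<Sum>k\<in>K. \<bar>c j\<bar> * \<bar>c k\<bar> * r ^ gap j k)
      \<le> (\<Sum>j\<in>K. \<Sum>k\<in>K. ((c j)\<^sup>2 + (c k)\<^sup>2) / 2 * r ^ gap j k)"
  proof (intro sum_mono mult_right_mono)
    fix j k
    show "\<bar>c j\<bar> * \<bar>c k\<bar> \<le> ((c j)\<^sup>2 + (c k)\<^sup>2) / 2"
      using sum_squares_bound[of "\<bar>c j\<bar>" "\<bar>c k\<bar>"] by (simp add: field_simps)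
  qed (use r in auto)
  also have "\<dots> = (\<Sum>j\<in>K. \<Sum>k\<in>K. (c j)\<^sup>2 / 2 * r ^ gap j k) + (\<Sum>j\<in>K. \<Sum>k\<in>K. (c k)\<^sup>2 / 2 * r ^ gap j k)"
    by (simp add: sum.distrib[symmetric] field_simps)
  also have "(\<Sum>j\<in>K. \<Sum>k\<in>K. (c k)\<^sup>2 / 2 * r ^ gap j k) = (\<Sum>j\<in>K. \<Sum>k\<in>K. (c j)\<^sup>2 / 2 * r ^ gap j k)"
    by (subst sum.swap) (simp add: gap_commute)
  also have "(\<Sum>j\<in>K. \<Sum>k\<in>K. (c j)\<^sup>2 / 2 * r ^ gap j k) + (\<Sum>j\<in>K. \<Sum>k\<in>K. (c j)\<^sup>2 / 2 * r ^ gap j k)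
      = (\<Sum>j\<in>K. (c j)\<^sup>2 * (\<Sum>k\<in>K. r ^ gap j k))"
    by (simp add: sum_distrib_left sum.distrib[symmetric] field_simps)
  also have "\<dots> \<le> (\<Sum>j\<in>K. (c j)\<^sup>2 * (2 / (1 - r)))"
    by (intro sum_mono mult_left_mono sum_power_gap_le r K) auto
  finally show ?thesis
    by (simp add: sum_distrib_left sum_distrib_right mult_ac)
qed

lemma weighted_sum_square_le:
  fixes c v :: "'i \<Rightarrow> real"
  assumes "\<And>k. k \<in> K \<Longrightarrow> v k > 0"
  shows "(\<Sum>k\<in>K. c k)\<^sup>2 \<le> (\<Sum>k\<in>K. v k) * (\<Sum>k\<in>K. (c k)\<^sup>2 / v k)"
proof -
  have "(\<Sum>k\<in>K. c k)\<^sup>2 = (\<Sum>k\<in>K. sqrt (v k) * (c k / sqrt (v k)))\<^sup>2"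
    using assms by (intro arg_cong[where f = "\<lambda>x. x\<^sup>2"] sum.cong) (auto simp: less_imp_neq[THEN not_sym])
  also have "\<dots> \<le> (\<Sum>k\<in>K. (sqrt (v k))\<^sup>2) * (\<Sum>k\<in>K. (c k / sqrt (v k))\<^sup>2)"
    by (rule Cauchy_Schwarz_ineq_sum)
  also have "\<dots> = (\<Sum>k\<in>K. v k) * (\<Sum>k\<in>K. (c k)\<^sup>2 / v k)"
    using assms by (intro arg_cong2[where f = "(*)"] sum.cong) (auto simp: power_divide less_imp_le)
  finally show ?thesis .
qed

section \<open>Pointwise convergence of the sine series\<close>

text \<open>Dirichlet's test in the form needed for sine series: the differences \<open>B m - B (Suc m)\<close> telescope to
bounded sums. Writing the term as \<open>(c m * B m - c (Suc m) * B (Suc m)) + (c (Suc m) - c m) * B (Suc m)\<close>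
splits the series into a telescoping one and an absolutely convergent one.\<close>

lemma summable_scaled_telescoping:
  fixes c B :: "nat \<Rightarrow> real"
  assumes c: "decseq c" "c \<longlonglongrightarrow> 0" and B: "\<And>m. \<bar>B m\<bar> \<le> 1"
  shows "summable (\<lambda>m. c m * (B m - B (Suc m)))"
proof -
  have cn: "c (Suc m) \<le> c m" for m using c(1) by (simp add: decseq_Suc_iff)
  have lim: "(\<lambda>m. c m * B m) \<longlonglongrightarrow> 0"
  proof (rule Lim_null_comparison)
    show "\<forall>\<^sub>F m in sequentially. norm (c m * B m) \<le> c m"
    proof (intro always_eventually allI)
      fix m
      have "c m \<ge> 0" using c by (rule decseq_ge)
      then show "norm (c m * B m) \<le> c m"
        using mult_left_mono[OF B[of m], of "c m"] by (simp add: abs_mult)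
    qed
  qed (rule c(2))
  have 1: "summable (\<lambda>m. c m * B m - c (Suc m) * B (Suc m))"
    using telescope_summable'[OF lim] by simp
  have "summable (\<lambda>m. (c m - c (Suc m)))"
    using telescope_summable'[OF c(2)] by simp
  then have 2: "summable (\<lambda>m. (c (Suc m) - c m) * B (Suc m))"
  proof (rule summable_comparison_test[rotated], intro exI allI impI)
    fix m
    have "\<bar>c (Suc m) - c m\<bar> * \<bar>B (Suc m)\<bar> \<le> \<bar>c (Suc m) - c m\<bar> * 1"
      by (intro mult_left_mono B) auto
    then show "norm ((c (Suc m) - c m) * B (Suc m)) \<le> c m - c (Suc m)"
      using cn[of m] by (simp add: abs_mult)
  qed
  show ?thesis
    using summable_add[OF 1 2] by (simp add: algebra_simps)
qed

definition davenport_partial :: "real \<Rightarrow> nat \<Rightarrow> real \<Rightarrow> real" where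
  "davenport_partial lam M x = (\<Sum>m<M. sin (2 * pi * real (Suc m) * x) / real (Suc m) powr lam)"

lemma davenport_partial_LIMSEQ:
  assumes "lam > 0"
  shows "(\<lambda>M. davenport_partial lam M x) \<longlonglongrightarrow> davenport lam x"
proof -
  have "summable (\<lambda>m. sin (2 * pi * real (Suc m) * x) / real (Suc m) powr lam)"
    (* For integer x all terms vanish; otherwise 2 sin (pi x) times the m-th sine is a difference of cosines. *)
  proof (cases "sin (pi * x) = 0")
    case True
    then obtain i :: int where "pi * x = of_int i * pi"
      using sin_zero_iff_int2 by blast
    then have x: "x = of_int i" by simp
    have "sin (2 * pi * real (Suc m) * x) = 0" for m
    proof -
      have "2 * pi * real (Suc m) * x = pi * of_int (2 * int (Suc m) * i)"
        by (simp add: x)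
      then show ?thesis
        using sin_npi_int by metis
    qed
    then show ?thesis by simp
  next
    case False
    define c where "c = (\<lambda>m. 1 / real (Suc m) powr lam)"
    define B where "B = (\<lambda>m. cos ((2 * real m + 1) * (pi * x)))"
    have "decseq c"
      unfolding c_def decseq_Suc_iff using assms by (auto intro!: divide_left_mono powr_mono2)
    moreover have "c \<longlonglongrightarrow> 0"
    proof -
      have "(\<lambda>m. real (Suc m) powr (- lam)) \<longlonglongrightarrow> 0"
        using assms by (intro tendsto_neg_powr filterlim_compose[OF filterlim_real_sequentially filterlim_Suc]) auto
      then show ?thesis by (simp add: c_def powr_minus_divide)
    qed
    ultimately have "summable (\<lambda>m. c m * (B m - B (Suc m)))"
      by (rule summable_scaled_telescoping) (simp add: B_def)
    also have "(\<lambda>m. c m * (B m - B (Suc m)))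
        = (\<lambda>m. 2 * sin (pi * x) * (sin (2 * pi * real (Suc m) * x) / real (Suc m) powr lam))"
    proof
      fix m
      have "B m - B (Suc m) = 2 * sin (2 * pi * real (Suc m) * x) * sin (pi * x)"
        unfolding B_def cos_diff_cos by (intro arg_cong2[where f = "\<lambda>u v. 2 * sin u * sin v"]) (simp_all add: field_simps)
      then show "c m * (B m - B (Suc m)) = 2 * sin (pi * x) * (sin (2 * pi * real (Suc m) * x) / real (Suc m) powr lam)"
        by (simp add: c_def)
    qed
    finally show ?thesis
      using False by (subst (asm) summable_cmult_iff) auto
  qed
  then show ?thesis
    unfolding davenport_def davenport_partial_def by (rule summable_LIMSEQ)
qed

section \<open>Square integrable functions with a bound on the norm\<close>

text \<open>A bound on the squared \<open>L\<^sup>2\<close> norm that carries measurability and integrability with it, so that the usual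
rules (domination, Cauchy-Schwarz, Fatou) keep all side conditions together.\<close>

definition sqint_le :: "'a measure \<Rightarrow> ('a \<Rightarrow> real) \<Rightarrow> real \<Rightarrow> bool" where
  "sqint_le M u B \<longleftrightarrow> u \<in> borel_measurable M \<and> integrable M (\<lambda>x. (u x)\<^sup>2) \<and> (\<integral>x. (u x)\<^sup>2 \<partial>M) \<le> B"

lemma sqint_le_measurable: "sqint_le M u B \<Longrightarrow> u \<in> borel_measurable M"
  by (simp add: sqint_le_def)

lemma sqint_le_nonneg: "sqint_le M u B \<Longrightarrow> B \<ge> 0"
proof -
  assume "sqint_le M u B"
  moreover have "0 \<le> (\<integral>x. (u x)\<^sup>2 \<partial>M)" by (rule Bochner_Integration.integral_nonneg) simp
  ultimately show "B \<ge> 0" unfolding sqint_le_def by linarith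
qed

lemma sqint_le_mono: "sqint_le M u A \<Longrightarrow> A \<le> B \<Longrightarrow> sqint_le M u B"
  by (auto simp: sqint_le_def)

lemma sqint_le_nn_integral:
  assumes "sqint_le M u B"
  shows "(\<integral>\<^sup>+x. ennreal ((u x)\<^sup>2) \<partial>M) \<le> ennreal B"
  using assms by (subst nn_integral_eq_integral) (auto simp: sqint_le_def ennreal_leI)

lemma sqint_leI:
  assumes "u \<in> borel_measurable M" "(\<integral>\<^sup>+x. ennreal ((u x)\<^sup>2) \<partial>M) \<le> ennreal B" "0 \<le> B"
  shows "sqint_le M u B"
proof -
  have int: "integrable M (\<lambda>x. (u x)\<^sup>2)"
    using assms by (intro integrableI_bounded) (auto simp: top.not_eq_extremum intro: le_less_trans)
  moreover have "ennreal (\<integral>x. (u x)\<^sup>2 \<partial>M) \<le> ennreal B"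
    using assms(2) int by (subst (asm) nn_integral_eq_integral) auto
  ultimately show ?thesis
    using assms by (auto simp: sqint_le_def)
qed

lemma sqint_le_bound:
  assumes "sqint_le M v B" "u \<in> borel_measurable M" "\<And>x. x \<in> space M \<Longrightarrow> \<bar>u x\<bar> \<le> \<bar>v x\<bar>"
  shows "sqint_le M u B"
proof -
  have le: "(u x)\<^sup>2 \<le> (v x)\<^sup>2" if "x \<in> space M" for x
    using assms(3)[OF that] by (simp add: abs_le_square_iff)
  have "integrable M (\<lambda>x. (u x)\<^sup>2)"
    by (rule Bochner_Integration.integrable_bound[of M "\<lambda>x. (v x)\<^sup>2"])
      (use assms le in \<open>auto simp: sqint_le_def\<close>)
  moreover from this have "(\<integral>x. (u x)\<^sup>2 \<partial>M) \<le> (\<integral>x. (v x)\<^sup>2 \<partial>M)"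
    using assms(1) le by (intro integral_mono) (auto simp: sqint_le_def)
  ultimately show ?thesis
    using assms by (auto simp: sqint_le_def)
qed

lemma sqint_le_cong:
  assumes "sqint_le M v B" "\<And>x. x \<in> space M \<Longrightarrow> u x = v x"
  shows "sqint_le M u B"
proof (rule sqint_le_bound[OF assms(1)])
  show "u \<in> borel_measurable M"
    using assms(2) sqint_le_measurable[OF assms(1)] by (simp cong: measurable_cong)
qed (simp add: assms(2))

lemma sqint_le_cmult:
  assumes "sqint_le M u B"
  shows "sqint_le M (\<lambda>x. c * u x) (c\<^sup>2 * B)"
  using assms by (auto simp: sqint_le_def power_mult_distrib intro!: mult_left_mono)

lemma sqint_le_Cauchy_Schwarz:
  assumes u: "sqint_le M u A" and v: "sqint_le M v B"
  shows "integrable M (\<lambda>x. u x * v x)" and "(\<integral>x. \<bar>u x * v x\<bar> \<partial>M) \<le> sqrt (A * B)"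
    and "\<bar>\<integral>x. u x * v x \<partial>M\<bar> \<le> sqrt (A * B)"
proof -
  note [measurable] = sqint_le_measurable[OF u] sqint_le_measurable[OF v]
  show int: "integrable M (\<lambda>x. u x * v x)"
  proof (rule Bochner_Integration.integrable_bound[of M "\<lambda>x. (u x)\<^sup>2 + (v x)\<^sup>2"])
    have "\<bar>u x * v x\<bar> \<le> (u x)\<^sup>2 + (v x)\<^sup>2" for x
    proof -
      have "2 * (\<bar>u x\<bar> * \<bar>v x\<bar>) \<le> (u x)\<^sup>2 + (v x)\<^sup>2"
        using sum_squares_bound[of "\<bar>u x\<bar>" "\<bar>v x\<bar>"] by (simp add: mult.assoc)
      moreover have "0 \<le> \<bar>u x\<bar> * \<bar>v x\<bar>" by simp
      ultimately show ?thesis unfolding abs_mult by linarith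
    qed
    then show "AE x in M. norm (u x * v x) \<le> norm ((u x)\<^sup>2 + (v x)\<^sup>2)"
      by auto
  qed (use u v in \<open>auto simp: sqint_le_def\<close>)
  have "(\<integral>\<^sup>+x. ennreal \<bar>u x\<bar> * ennreal \<bar>v x\<bar> \<partial>M)\<^sup>2
      \<le> (\<integral>\<^sup>+x. (ennreal \<bar>u x\<bar>)\<^sup>2 \<partial>M) * (\<integral>\<^sup>+x. (ennreal \<bar>v x\<bar>)\<^sup>2 \<partial>M)"
    by (rule Cauchy_Schwarz_nn_integral) auto
  also have "\<dots> \<le> ennreal A * ennreal B"
    using sqint_le_nn_integral[OF u] sqint_le_nn_integral[OF v]
    by (intro mult_mono) (auto simp: ennreal_power)
  also have "(\<integral>\<^sup>+x. ennreal \<bar>u x\<bar> * ennreal \<bar>v x\<bar> \<partial>M) = ennreal (\<integral>x. \<bar>u x * v x\<bar> \<partial>M)"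
    using integrable_abs[OF int]
    by (subst nn_integral_eq_integral[symmetric]) (simp_all add: ennreal_mult abs_mult)
  finally have "ennreal ((\<integral>x. \<bar>u x * v x\<bar> \<partial>M)\<^sup>2) \<le> ennreal (A * B)"
    using sqint_le_nonneg[OF u] sqint_le_nonneg[OF v] by (simp add: ennreal_power ennreal_mult)
  then have "(\<integral>x. \<bar>u x * v x\<bar> \<partial>M)\<^sup>2 \<le> A * B"
    using sqint_le_nonneg[OF u] sqint_le_nonneg[OF v] by (simp add: ennreal_le_iff)
  then show 1: "(\<integral>x. \<bar>u x * v x\<bar> \<partial>M) \<le> sqrt (A * B)"
    by (rule real_le_rsqrt)
  have "\<bar>\<integral>x. u x * v x \<partial>M\<bar> \<le> (\<integral>x. \<bar>u x * v x\<bar> \<partial>M)"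
    by (rule integral_abs_bound)
  from order_trans[OF this 1] show "\<bar>\<integral>x. u x * v x \<partial>M\<bar> \<le> sqrt (A * B)" .
qed

text \<open>A substitute for Minkowski's inequality that stays at the level of squared norms; with geometric
weights \<open>v\<close> it loses only a constant when the norms of the summands decay geometrically.\<close>

lemma sqint_le_sum_weighted:
  assumes "\<And>k. k \<in> K \<Longrightarrow> sqint_le M (u k) (B k)" "\<And>k. k \<in> K \<Longrightarrow> v k > 0"
  shows "sqint_le M (\<lambda>x. \<Sum>k\<in>K. u k x) ((\<Sum>k\<in>K. v k) * (\<Sum>k\<in>K. B k / v k))"
proof -
  have meas: "(\<lambda>x. \<Sum>k\<in>K. u k x) \<in> borel_measurable M"
    using assms(1) by (intro borel_measurable_sum sqint_le_measurable[OF assms(1)])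
  have int: "integrable M (\<lambda>x. (\<Sum>k\<in>K. v k) * (\<Sum>k\<in>K. (u k x)\<^sup>2 / v k))"
    using assms by (auto simp: sqint_le_def)
  have le: "(\<Sum>k\<in>K. u k x)\<^sup>2 \<le> (\<Sum>k\<in>K. v k) * (\<Sum>k\<in>K. (u k x)\<^sup>2 / v k)" for x
    using assms(2) by (rule weighted_sum_square_le)
  have v0: "(\<Sum>k\<in>K. v k) \<ge> 0"
    using assms(2) by (intro sum_nonneg less_imp_le)
  have "0 \<le> (\<Sum>k\<in>K. (u k x)\<^sup>2 / v k)" for x
    using assms(2) by (auto intro!: sum_nonneg divide_nonneg_pos)
  with v0 have nn: "0 \<le> (\<Sum>k\<in>K. v k) * (\<Sum>k\<in>K. (u k x)\<^sup>2 / v k)" for x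
    by auto
  have int2: "integrable M (\<lambda>x. (\<Sum>k\<in>K. u k x)\<^sup>2)"
    by (rule Bochner_Integration.integrable_bound[OF int]) (use meas le nn in auto)
  have "(\<integral>x. (\<Sum>k\<in>K. u k x)\<^sup>2 \<partial>M) \<le> (\<integral>x. (\<Sum>k\<in>K. v k) * (\<Sum>k\<in>K. (u k x)\<^sup>2 / v k) \<partial>M)"
    by (rule integral_mono[OF int2 int le])
  also have "\<dots> = (\<Sum>k\<in>K. v k) * (\<Sum>k\<in>K. (\<integral>x. (u k x)\<^sup>2 \<partial>M) / v k)"
    using assms(1) by (simp add: sqint_le_def)
  also have "\<dots> \<le> (\<Sum>k\<in>K. v k) * (\<Sum>k\<in>K. B k / v k)"
    using assms v0 by (intro mult_left_mono sum_mono divide_right_mono) (auto simp: sqint_le_def less_imp_le)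
  finally show ?thesis
    using meas int2 by (simp add: sqint_le_def)
qed

lemma sqint_le_sum:
  assumes "\<And>k. k \<in> K \<Longrightarrow> sqint_le M (u k) (B k)"
  shows "sqint_le M (\<lambda>x. \<Sum>k\<in>K. u k x) (real (card K) * (\<Sum>k\<in>K. B k))"
  using sqint_le_sum_weighted[of K M u B "\<lambda>_. 1"] assms by simp

text \<open>Fatou's lemma: norm bounds survive almost everywhere limits.\<close>

lemma sqint_le_limit:
  assumes u: "u \<in> borel_measurable M" and "AE x in M. (\<lambda>i. w i x) \<longlonglongrightarrow> u x"
    and w: "\<And>i. i \<ge> start \<Longrightarrow> sqint_le M (w i) B"
  shows "sqint_le M u B"
proof (rule sqint_leI[OF u])
  define w' where "w' = (\<lambda>i. w (i + start))"
  have w': "sqint_le M (w' i) B" for i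
    unfolding w'_def by (rule w) simp
  note [measurable] = sqint_le_measurable[OF w']
  have "AE x in M. (\<lambda>i. w' i x) \<longlonglongrightarrow> u x"
    using assms(2) by eventually_elim (auto simp: w'_def intro: LIMSEQ_ignore_initial_segment)
  then have "AE x in M. ennreal ((u x)\<^sup>2) = liminf (\<lambda>i. ennreal ((w' i x)\<^sup>2))"
  proof eventually_elim
    case (elim x)
    then have "(\<lambda>i. ennreal ((w' i x)\<^sup>2)) \<longlonglongrightarrow> ennreal ((u x)\<^sup>2)"
      by (intro tendsto_ennrealI tendsto_power)
    then show ?case
      by (intro lim_imp_Liminf[symmetric]) simp_all
  qed
  then have "(\<integral>\<^sup>+x. ennreal ((u x)\<^sup>2) \<partial>M) = (\<integral>\<^sup>+x. liminf (\<lambda>i. ennreal ((w' i x)\<^sup>2)) \<partial>M)"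
    by (rule nn_integral_cong_AE)
  also have "\<dots> \<le> liminf (\<lambda>i. \<integral>\<^sup>+x. ennreal ((w' i x)\<^sup>2) \<partial>M)"
    by (rule nn_integral_liminf) simp
  also have "\<dots> \<le> liminf (\<lambda>i. ennreal B)"
    by (intro Liminf_mono always_eventually allI sqint_le_nn_integral w')
  also have "\<dots> = ennreal B"
    by (simp add: Liminf_const)
  finally show "(\<integral>\<^sup>+x. ennreal ((u x)\<^sup>2) \<partial>M) \<le> ennreal B" .
  show "B \<ge> 0" using sqint_le_nonneg[OF w'] .
qed

lemma sqint_le_limit_pointwise:
  assumes "\<And>x. x \<in> space M \<Longrightarrow> (\<lambda>i. w i x) \<longlonglongrightarrow> u x"
    and w: "\<And>i. i \<ge> start \<Longrightarrow> sqint_le M (w i) B"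
  shows "sqint_le M u B"
proof (rule sqint_le_limit[OF _ _ w])
  show "u \<in> borel_measurable M"
    by (rule borel_measurable_LIMSEQ_real[where u = "\<lambda>i. w (i + start)"])
      (use assms(1) in \<open>auto intro: LIMSEQ_ignore_initial_segment sqint_le_measurable[OF w]\<close>)
qed (use assms in auto)

lemma sqint_le_indicator:
  assumes "A \<in> sets M" "emeasure M A < \<infinity>"
  shows "sqint_le M (indicator A) (measure M A)"
proof -
  have "(\<lambda>x. (indicator A x)\<^sup>2 :: real) = indicator A"
    by (auto simp: indicator_def)
  then show ?thesis
    using assms by (auto simp: sqint_le_def)
qed

lemma sqint_le_one:
  assumes "finite_measure M"
  shows "sqint_le M (\<lambda>x. 1) (measure M (space M))"
  using assms by (auto simp: sqint_le_def finite_measure_def finite_measure.integrable_const)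

text \<open>Completeness of \<open>L\<^sup>2\<close> with a rate. On a finite measure space the sequence is Cauchy in \<open>L\<^sup>1\<close>, which gives an
almost everywhere convergent subsequence; Fatou's lemma then transfers the rate to its limit.\<close>

lemma L2_Cauchy_limit:
  assumes fin: "finite_measure M" and int: "\<And>K. sqint_le M (s K) (A K)"
    and cauchy: "\<And>J K. J \<le> K \<Longrightarrow> sqint_le M (\<lambda>x. s K x - s J x) (B J)"
    and B: "B \<longlonglongrightarrow> 0"
  obtains S where "S \<in> borel_measurable M" "\<And>J. sqint_le M (\<lambda>x. S x - s J x) (B J)"
proof -
  let ?m = "measure M (space M)"
  have Bn: "B J \<ge> 0" for J
    using sqint_le_nonneg[OF cauchy[of J J]] by simp
  note [measurable] = sqint_le_measurable[OF int]
  have s1: "integrable M (s K)" for K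
    using sqint_le_Cauchy_Schwarz(1)[OF int[of K] sqint_le_one[OF fin]] by simp
  have near: "(\<integral>x. \<bar>s K x - s J x\<bar> \<partial>M) \<le> sqrt (B J * ?m)" if "J \<le> K" for J K
    using sqint_le_Cauchy_Schwarz(2)[OF cauchy[OF that] sqint_le_one[OF fin]] by simp
  have "\<exists>N. \<forall>i\<ge>N. \<forall>j\<ge>N. (\<integral>x. norm (s i x - s j x) \<partial>M) < e" if "e > 0" for e
  proof -
    have "(\<lambda>J. sqrt (B J * ?m)) \<longlonglongrightarrow> sqrt (0 * ?m)"
      by (intro tendsto_intros B)
    then have "\<forall>\<^sub>F J in sequentially. sqrt (B J * ?m) < e"
      using that by (intro order_tendstoD) auto
    then obtain N where N: "\<And>J. J \<ge> N \<Longrightarrow> sqrt (B J * ?m) < e"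
      by (auto simp: eventually_sequentially)
    have "(\<integral>x. norm (s i x - s j x) \<partial>M) < e" if "i \<ge> N" "j \<ge> N" for i j
    proof (cases "j \<le> i")
      case True
      then show ?thesis using near[OF True] N[OF that(2)] by simp
    next
      case False
      then have "i \<le> j" by simp
      then show ?thesis using near[OF \<open>i \<le> j\<close>] N[OF that(1)] by (simp add: abs_minus_commute)
    qed
    then show ?thesis by blast
  qed
  then obtain r where r: "strict_mono r" "AE x in M. Cauchy (\<lambda>i. s (r i) x)"
    using cauchy_L1_AE_cauchy_subseq[of M s] s1 by blast
  define S where "S = (\<lambda>x. lim (\<lambda>i. s (r i) x))"
  have S [measurable]: "S \<in> borel_measurable M"
    unfolding S_def by (rule borel_measurable_lim_metric) simp
  have conv: "AE x in M. (\<lambda>i. s (r i) x) \<longlonglongrightarrow> S x"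
    using r(2) by eventually_elim (simp add: S_def Cauchy_convergent_iff convergent_LIMSEQ_iff)
  have "sqint_le M (\<lambda>x. S x - s J x) (B J)" for J
  proof (rule sqint_le_limit[where w = "\<lambda>i x. s (r i) x - s J x" and start = J])
    show "AE x in M. (\<lambda>i. s (r i) x - s J x) \<longlonglongrightarrow> S x - s J x"
      using conv by eventually_elim (intro tendsto_intros)
    show "sqint_le M (\<lambda>x. s (r i) x - s J x) (B J)" if "i \<ge> J" for i
      by (rule cauchy) (rule order_trans[OF that seq_suble[OF r(1)]])
  qed simp
  then show ?thesis using that S by blast
qed

text \<open>By monotone convergence \<open>\<Sum> (T N)\<^sup>2\<close> is integrable, hence almost everywhere finite, so that its terms tend
to zero.\<close>

lemma AE_LIMSEQ_zero_of_summable_sqint: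
  assumes T: "\<And>N. sqint_le M (T N) (B N)" and B: "summable B"
  shows "AE x in M. (\<lambda>N. T N x) \<longlonglongrightarrow> 0"
proof -
  note [measurable] = sqint_le_measurable[OF T]
  have "(\<integral>\<^sup>+x. (\<Sum>N. ennreal ((T N x)\<^sup>2)) \<partial>M) = (\<Sum>N. \<integral>\<^sup>+x. ennreal ((T N x)\<^sup>2) \<partial>M)"
    by (rule nn_integral_suminf) simp
  also have "\<dots> \<le> (\<Sum>N. ennreal (B N))"
    by (intro suminf_le sqint_le_nn_integral T) auto
  also have "\<dots> < \<infinity>"
    using B sqint_le_nonneg[OF T] by (simp add: suminf_ennreal2 less_top[symmetric])
  finally have "AE x in M. (\<Sum>N. ennreal ((T N x)\<^sup>2)) \<noteq> \<infinity>"
    by (intro nn_integral_PInf_AE) auto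
  then show ?thesis
  proof eventually_elim
    case (elim x)
    then have "summable (\<lambda>N. (T N x)\<^sup>2)"
      by (intro summable_suminf_not_top) auto
    then have "(\<lambda>N. sqrt ((T N x)\<^sup>2)) \<longlonglongrightarrow> sqrt 0"
      by (intro tendsto_real_sqrt summable_LIMSEQ_zero)
    then show ?case
      by (simp add: tendsto_rabs_zero_iff)
  qed
qed

section \<open>Trigonometric polynomials on symmetric intervals\<close>

text \<open>Symmetric intervals with integer end points consist of whole periods, so exponentials with distinct integer
frequencies stay orthogonal; they exhaust the line; and averages over radius at most \<open>1\<close> around points of
one of them only involve the next one.\<close>

abbreviation sym_interval :: "nat \<Rightarrow> real measure" where
  "sym_interval L \<equiv> restrict_space lborel {- real L..real L}"

lemma finite_measure_sym_interval: "finite_measure (sym_interval L)"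
  by (rule finite_measureI) (simp add: emeasure_restrict_space space_restrict_space)

lemma measure_sym_interval [simp]: "measure (sym_interval L) (space (sym_interval L)) = 2 * real L"
  by (simp add: measure_restrict_space space_restrict_space)

lemma measurable_sym_interval: "u \<in> borel_measurable borel \<Longrightarrow> u \<in> borel_measurable (sym_interval L)"
  by (rule measurable_restrict_space1) simp

lemma integral_sym_interval:
  "(\<integral>x. u x \<partial>sym_interval L) = (\<integral>x. indicator {- real L..real L} x * u x \<partial>lborel)"
  for u :: "real \<Rightarrow> real"
  by (subst integral_restrict_space) simp_all

lemma integrable_sym_interval:
  "integrable (sym_interval L) u \<longleftrightarrow> integrable lborel (\<lambda>x. indicator {- real L..real L} x * u x)"
  for u :: "real \<Rightarrow> real"
  by (subst integrable_restrict_space) simp_all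

lemma continuous_integrable_sym_interval:
  fixes u :: "real \<Rightarrow> real"
  assumes "continuous_on UNIV u"
  shows "integrable (sym_interval L) u"
proof -
  have "set_integrable lborel {- real L..real L} u"
    by (rule borel_integrable_atLeastAtMost') (rule continuous_on_subset[OF assms], simp)
  then show ?thesis
    by (simp add: integrable_sym_interval set_integrable_def)
qed

lemma integral_cos_sym_interval:
  fixes j :: int
  shows "(\<integral>x. cos (2 * pi * of_int j * x) \<partial>sym_interval L) = (if j = 0 then 2 * real L else 0)"
proof (cases "j = 0")
  case True
  have "(\<integral>x. 1 \<partial>sym_interval L) = (2 * real L :: real)"
    using measure_sym_interval by simp
  then show ?thesis
    using True by simp
next
  case False
  have "(\<integral>x. cos (2 * pi * of_int j * x) * indicator {- real L..real L} x \<partial>lborel)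
      = sin (2 * pi * of_int j * real L) / (2 * pi * of_int j) - sin (2 * pi * of_int j * (- real L)) / (2 * pi * of_int j)"
    using False by (intro integral_FTC_Icc_real) (auto intro!: derivative_eq_intros continuous_intros)
  also have "\<dots> = 0"
    using sin_npi_int[of "2 * j * int L"] by (simp add: mult_ac)
  finally show ?thesis
    using False by (simp add: integral_sym_interval mult.commute)
qed

text \<open>Parseval for the exponential polynomial \<open>\<Sum> c i * exp (2 * pi * \<i> * \<nu> i * x)\<close>, written as the sum of the
squares of its real and imaginary parts. Frequencies may coincide, which the fourth moment below needs.\<close>

lemma parseval_sym_interval:
  fixes c :: "'i \<Rightarrow> real" and \<nu> :: "'i \<Rightarrow> nat"
  shows "(\<integral>x. (\<Sum>i\<in>I. c i * cos (2 * pi * real (\<nu> i) * x))\<^sup>2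
              + (\<Sum>i\<in>I. c i * sin (2 * pi * real (\<nu> i) * x))\<^sup>2 \<partial>sym_interval L)
      = 2 * real L * (\<Sum>i\<in>I. \<Sum>j\<in>I. if \<nu> i = \<nu> j then c i * c j else 0)"
proof -
  have eq: "(\<Sum>i\<in>I. c i * cos (2 * pi * real (\<nu> i) * x))\<^sup>2 + (\<Sum>i\<in>I. c i * sin (2 * pi * real (\<nu> i) * x))\<^sup>2
      = (\<Sum>i\<in>I. \<Sum>j\<in>I. c i * c j * cos (2 * pi * of_int (int (\<nu> i) - int (\<nu> j)) * x))" for x
    by (simp add: power2_eq_square sum_product sum.distrib[symmetric] cos_diff algebra_simps)
  have int: "integrable (sym_interval L) (\<lambda>x. a * cos (2 * pi * of_int j * x))" for a and j :: int
    by (intro continuous_integrable_sym_interval continuous_intros)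
  have "(\<integral>x. (\<Sum>i\<in>I. c i * cos (2 * pi * real (\<nu> i) * x))\<^sup>2
              + (\<Sum>i\<in>I. c i * sin (2 * pi * real (\<nu> i) * x))\<^sup>2 \<partial>sym_interval L)
      = (\<Sum>i\<in>I. \<Sum>j\<in>I. c i * c j * (\<integral>x. cos (2 * pi * of_int (int (\<nu> i) - int (\<nu> j)) * x) \<partial>sym_interval L))"
    unfolding eq by (subst Bochner_Integration.integral_sum; (intro Bochner_Integration.integrable_sum int)?)+ simp
  also have "\<dots> = (\<Sum>i\<in>I. \<Sum>j\<in>I. 2 * real L * (if \<nu> i = \<nu> j then c i * c j else 0))"
    by (intro sum.cong refl) (simp only: integral_cos_sym_interval, simp)
  finally show ?thesis
    by (simp add: sum_distrib_left)
qed

lemma sqint_le_sine_polynomial: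
  fixes c :: "'i \<Rightarrow> real" and \<nu> :: "'i \<Rightarrow> nat"
  assumes "finite I" "inj_on \<nu> I"
  shows "sqint_le (sym_interval L) (\<lambda>x. \<Sum>i\<in>I. c i * sin (2 * pi * real (\<nu> i) * x)) (2 * real L * (\<Sum>i\<in>I. (c i)\<^sup>2))"
proof -
  let ?s = "\<lambda>x. \<Sum>i\<in>I. c i * sin (2 * pi * real (\<nu> i) * x)"
  let ?c = "\<lambda>x. \<Sum>i\<in>I. c i * cos (2 * pi * real (\<nu> i) * x)"
  have "(\<integral>x. (?s x)\<^sup>2 \<partial>sym_interval L) \<le> (\<integral>x. (?c x)\<^sup>2 + (?s x)\<^sup>2 \<partial>sym_interval L)"
    by (intro integral_mono continuous_integrable_sym_interval continuous_intros) simp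
  also have "\<dots> = 2 * real L * (\<Sum>i\<in>I. \<Sum>j\<in>I. if i = j then c i * c j else 0)"
    unfolding parseval_sym_interval
    by (intro arg_cong2[where f = "(*)"] sum.cong refl) (use assms in \<open>auto simp: inj_on_def\<close>)
  also have "\<dots> = 2 * real L * (\<Sum>i\<in>I. (c i)\<^sup>2)"
    using assms by (simp add: power2_eq_square)
  finally show ?thesis
    unfolding sqint_le_def
    by (intro conjI measurable_sym_interval continuous_integrable_sym_interval continuous_intros
        borel_measurable_continuous_onI)
qed

lemma integral_sin_sin_sym_interval:
  assumes "m > 0" "n > 0"
  shows "(\<integral>x. sin (2 * pi * real m * x) * sin (2 * pi * real n * x) \<partial>sym_interval L) = (if m = n then real L else 0)"
proof -
  have eq: "sin (2 * pi * real m * x) * sin (2 * pi * real n * x)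
      = cos (2 * pi * of_int (int m - int n) * x) / 2 - cos (2 * pi * of_int (int m + int n) * x) / 2" for x
    by (simp add: sin_times_sin algebra_simps diff_divide_distrib)
  show ?thesis
    unfolding eq
    by (subst Bochner_Integration.integral_diff)
      (use assms in \<open>auto intro!: continuous_integrable_sym_interval continuous_intros simp only: integral_cos_sym_interval
        Bochner_Integration.integral_divide_zero, auto\<close>)
qed

text \<open>If each frequency is at least twice every earlier one, then \<open>\<nu> i + \<nu> j\<close> with \<open>i \<le> j\<close> lies between \<open>\<nu> j\<close>
(excluded) and \<open>2 * \<nu> j\<close> (included). These ranges are disjoint for different \<open>j\<close>, so the sum determines the pair.\<close>

lemma sum_pair_eq_lacunary:
  fixes \<nu> :: "nat \<Rightarrow> nat"
  assumes lac: "\<And>i j. i \<in> J \<Longrightarrow> j \<in> J \<Longrightarrow> i < j \<Longrightarrow> 2 * \<nu> i \<le> \<nu> j" and pos: "\<And>j. j \<in> J \<Longrightarrow> \<nu> j > 0"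
    and J: "i \<in> J" "j \<in> J" "k \<in> J" "l \<in> J" and eq: "\<nu> i + \<nu> j = \<nu> k + \<nu> l"
  shows "(i = k \<and> j = l) \<or> (i = l \<and> j = k)"
proof -
  have less: "\<nu> a < \<nu> b" if "a \<in> J" "b \<in> J" "a < b" for a b
    using lac[OF that] pos[OF that(1)] by simp
  then have inj: "a = b" if "a \<in> J" "b \<in> J" "\<nu> a = \<nu> b" for a b
    using that by (metis less_irrefl linorder_less_linear)
  have key: "b = d" if "a \<in> J" "b \<in> J" "c \<in> J" "d \<in> J" "a \<le> b" "c \<le> d" "\<nu> a + \<nu> b = \<nu> c + \<nu> d" for a b c d
  proof (rule ccontr)
    assume "b \<noteq> d"
    then consider "b < d" | "d < b" by linarith
    then show False
    proof cases
      case 1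
      have "\<nu> a \<le> \<nu> b" using less[of a b] that by (cases "a = b") auto
      then show False using lac[OF that(2,4) 1] that(7) pos[OF that(3)] by linarith
    next
      case 2
      have "\<nu> c \<le> \<nu> d" using less[of c d] that by (cases "c = d") auto
      then show False using lac[OF that(4,2) 2] that(7) pos[OF that(1)] by linarith
    qed
  qed
  consider "i \<le> j" "k \<le> l" | "i \<le> j" "l \<le> k" | "j \<le> i" "k \<le> l" | "j \<le> i" "l \<le> k" by linarith
  then show ?thesis
  proof cases
    case 1 then show ?thesis using key[of i j k l] inj[of i k] J eq by auto
  next
    case 2 then show ?thesis using key[of i j l k] inj[of i l] J eq by auto
  next
    case 3 then show ?thesis using key[of j i k l] inj[of j k] J eq by auto
  next
    case 4 then show ?thesis using key[of j i l k] inj[of j l] J eq by auto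
  qed
qed

text \<open>The sine polynomial is the imaginary part of an exponential polynomial \<open>Z\<close>, and \<open>\<bar>Z\<bar>\<^sup>4 = \<bar>Z\<^sup>2\<bar>\<^sup>2\<close>. The
frequencies of \<open>Z\<^sup>2\<close> are the pair sums, each attained by at most two ordered pairs, so Parseval for \<open>Z\<^sup>2\<close>
bounds the fourth moment by twice the square of \<open>\<Sum> (c j)\<^sup>2\<close> times the length of the interval.\<close>

lemma fourth_power_lacunary:
  fixes c :: "nat \<Rightarrow> real" and \<nu> :: "nat \<Rightarrow> nat"
  assumes lac: "\<And>i j. i \<in> J \<Longrightarrow> j \<in> J \<Longrightarrow> i < j \<Longrightarrow> 2 * \<nu> i \<le> \<nu> j" and pos: "\<And>j. j \<in> J \<Longrightarrow> \<nu> j > 0"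
    and J: "finite J"
  shows "sqint_le (sym_interval L) (\<lambda>x. (\<Sum>j\<in>J. c j * sin (2 * pi * real (\<nu> j) * x))\<^sup>2)
    (4 * real L * (\<Sum>j\<in>J. (c j)\<^sup>2)\<^sup>2)"
proof -
  let ?s = "\<lambda>x. \<Sum>i\<in>J. c i * sin (2 * pi * real (\<nu> i) * x)"
  let ?c = "\<lambda>x. \<Sum>i\<in>J. c i * cos (2 * pi * real (\<nu> i) * x)"
  let ?d = "\<lambda>p. c (fst p) * c (snd p)" and ?\<mu> = "\<lambda>p. \<nu> (fst p) + \<nu> (snd p)"
  let ?C = "\<lambda>x. \<Sum>p\<in>J\<times>J. ?d p * cos (2 * pi * real (?\<mu> p) * x)"
  let ?S = "\<lambda>x. \<Sum>p\<in>J\<times>J. ?d p * sin (2 * pi * real (?\<mu> p) * x)"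
  have C: "?C x = (?c x)\<^sup>2 - (?s x)\<^sup>2" for x
    by (simp add: power2_eq_square sum_product sum_subtractf[symmetric] sum.cartesian_product
        case_prod_beta cos_add algebra_simps)
  have S: "?S x = 2 * ?c x * ?s x" for x
  proof -
    have "?S x = (\<Sum>i\<in>J. \<Sum>j\<in>J. (c i * sin (2 * pi * real (\<nu> i) * x)) * (c j * cos (2 * pi * real (\<nu> j) * x)))
        + (\<Sum>i\<in>J. \<Sum>j\<in>J. (c i * cos (2 * pi * real (\<nu> i) * x)) * (c j * sin (2 * pi * real (\<nu> j) * x)))"
      by (simp add: sum.distrib[symmetric] sum.cartesian_product case_prod_beta sin_add algebra_simps)
    then show ?thesis
      by (simp add: sum_product[symmetric])
  qed
  (* ?C and ?S are the real and imaginary parts of the square of ?c + i ?s. *)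
  have four: "(?C x)\<^sup>2 + (?S x)\<^sup>2 = ((?c x)\<^sup>2 + (?s x)\<^sup>2)\<^sup>2" for x
    unfolding C S by (simp add: power2_eq_square algebra_simps)
  have "(\<integral>x. ((?s x)\<^sup>2)\<^sup>2 \<partial>sym_interval L) \<le> (\<integral>x. (?C x)\<^sup>2 + (?S x)\<^sup>2 \<partial>sym_interval L)"
  proof (intro integral_mono continuous_integrable_sym_interval continuous_intros)
    show "((?s x)\<^sup>2)\<^sup>2 \<le> (?C x)\<^sup>2 + (?S x)\<^sup>2" for x
      unfolding four by (intro power_mono) auto
  qed
  also have "\<dots> = 2 * real L * (\<Sum>p\<in>J\<times>J. \<Sum>p'\<in>J\<times>J. if ?\<mu> p = ?\<mu> p' then ?d p * ?d p' else 0)"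
    by (rule parseval_sym_interval)
  also have "\<dots> \<le> 2 * real L * (\<Sum>p\<in>J\<times>J. 2 * (?d p)\<^sup>2)"
  proof (intro mult_left_mono sum_mono)
    fix p assume p: "p \<in> J \<times> J"
    let ?q = "(snd p, fst p)"
    have "(\<Sum>p'\<in>J\<times>J. if ?\<mu> p = ?\<mu> p' then ?d p * ?d p' else 0)
        \<le> (\<Sum>p'\<in>J\<times>J. (if p' = p then (?d p)\<^sup>2 else 0) + (if p' = ?q then (?d p)\<^sup>2 else 0))"
    proof (rule sum_mono)
      fix p' assume p': "p' \<in> J \<times> J"
      have "p' = p \<or> p' = ?q" if "?\<mu> p = ?\<mu> p'"
        using sum_pair_eq_lacunary[of J \<nu> "fst p" "snd p" "fst p'" "snd p'"] lac pos p p' that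
        by (auto simp: prod_eq_iff)
      moreover from this have "?d p * ?d p' = (?d p)\<^sup>2" if "?\<mu> p = ?\<mu> p'"
        using that by (auto simp: power2_eq_square)
      ultimately show "(if ?\<mu> p = ?\<mu> p' then ?d p * ?d p' else 0)
          \<le> (if p' = p then (?d p)\<^sup>2 else 0) + (if p' = ?q then (?d p)\<^sup>2 else 0)"
        using zero_le_power2[of "?d p"] by (cases "?\<mu> p = ?\<mu> p'") (simp_all del: zero_le_power2, auto)
    qed
    also have "\<dots> = 2 * (?d p)\<^sup>2"
      using J p by (auto simp: sum.distrib)
    finally show "(\<Sum>p'\<in>J\<times>J. if ?\<mu> p = ?\<mu> p' then ?d p * ?d p' else 0) \<le> 2 * (?d p)\<^sup>2" .
  qed simp
  also have "(\<Sum>p\<in>J\<times>J. 2 * (?d p)\<^sup>2) = (\<Sum>i\<in>J. \<Sum>j\<in>J. 2 * ((c i)\<^sup>2 * (c j)\<^sup>2))"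
    by (simp only: sum.cartesian_product case_prod_unfold power_mult_distrib)
  also have "\<dots> = 2 * (\<Sum>j\<in>J. (c j)\<^sup>2)\<^sup>2"
    unfolding power2_eq_square[of "sum _ _"] sum_product by (simp only: sum_distrib_left)
  finally show ?thesis
    unfolding sqint_le_def
    by (auto intro!: measurable_sym_interval continuous_integrable_sym_interval continuous_intros
        borel_measurable_continuous_onI)
qed

text \<open>Uniform integrability of squares of lacunary polynomials: Cauchy-Schwarz against the indicator and the
fourth moment give the factor \<open>sqrt (measure A)\<close>. Splitting the indices into residue classes modulo \<open>s\<close>
reduces an arbitrary lacunarity ratio to the ratio \<open>2\<close>.\<close>

lemma sqint_le_lacunary_on_subset:
  fixes c :: "nat \<Rightarrow> real" and \<nu> :: "nat \<Rightarrow> nat"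
  assumes s: "s > 0" and lac: "\<And>i j. i \<in> J \<Longrightarrow> j \<in> J \<Longrightarrow> i + s \<le> j \<Longrightarrow> 2 * \<nu> i \<le> \<nu> j"
    and pos: "\<And>j. j \<in> J \<Longrightarrow> \<nu> j > 0" and J: "finite J" and A: "A \<in> sets (sym_interval L)"
  shows "sqint_le (sym_interval L) (\<lambda>x. indicator A x * (\<Sum>j\<in>J. c j * sin (2 * pi * real (\<nu> j) * x)))
    (real s * sqrt (4 * real L * measure (sym_interval L) A) * (\<Sum>j\<in>J. (c j)\<^sup>2))"
proof -
  let ?M = "sym_interval L"
  interpret finite_measure ?M by (rule finite_measure_sym_interval)
  define R where "R = (\<lambda>t. {j \<in> J. j mod s = t})"
  define w where "w = (\<lambda>t x. \<Sum>j\<in>R t. c j * sin (2 * pi * real (\<nu> j) * x))"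
  have fin: "finite (R t)" for t using J by (simp add: R_def)
  have split: "(\<Sum>j\<in>J. g j) = (\<Sum>t<s. \<Sum>j\<in>R t. g j)" for g :: "nat \<Rightarrow> real"
  proof -
    have "(\<lambda>j. j mod s) ` J \<subseteq> {..<s}" using s by auto
    from sum.group[OF J _ this, of g] show ?thesis by (simp add: R_def)
  qed
  have part: "sqint_le ?M (\<lambda>x. indicator A x * w t x) (sqrt (4 * real L * measure ?M A) * (\<Sum>j\<in>R t. (c j)\<^sup>2))" for t
  proof -
    have four: "sqint_le ?M (\<lambda>x. (w t x)\<^sup>2) (4 * real L * (\<Sum>j\<in>R t. (c j)\<^sup>2)\<^sup>2)"
      unfolding w_def
    proof (rule fourth_power_lacunary)
      fix i j assume ij: "i \<in> R t" "j \<in> R t" "i < j"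
      then have "s dvd j - i"
        by (auto simp: R_def mod_eq_dvd_iff_nat)
      then have "i + s \<le> j"
        using ij(3) dvd_imp_le[of s "j - i"] by linarith
      then show "2 * \<nu> i \<le> \<nu> j"
        using ij lac by (auto simp: R_def)
    qed (use pos fin in \<open>auto simp: R_def\<close>)
    have ind: "sqint_le ?M (indicator A) (measure ?M A)"
      using A by (intro sqint_le_indicator) (auto simp: less_top[symmetric])
    have eq: "(indicator A x * w t x)\<^sup>2 = indicator A x * (w t x)\<^sup>2" for x
      by (auto simp: indicator_def)
    note CS = sqint_le_Cauchy_Schwarz[OF ind four]
    have "(\<integral>x. (indicator A x * w t x)\<^sup>2 \<partial>?M) \<le> sqrt (measure ?M A * (4 * real L * (\<Sum>j\<in>R t. (c j)\<^sup>2)\<^sup>2))"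
      unfolding eq using CS(3) by linarith
    also have "\<dots> = sqrt (4 * real L * measure ?M A) * (\<Sum>j\<in>R t. (c j)\<^sup>2)"
      by (simp add: real_sqrt_mult sum_nonneg)
    finally have "(\<integral>x. (indicator A x * w t x)\<^sup>2 \<partial>?M) \<le> sqrt (4 * real L * measure ?M A) * (\<Sum>j\<in>R t. (c j)\<^sup>2)" .
    moreover have "(\<lambda>x. indicator A x * w t x) \<in> borel_measurable ?M"
      unfolding w_def
      by (intro borel_measurable_times borel_measurable_indicator[OF A] measurable_sym_interval
          borel_measurable_continuous_onI continuous_intros)
    moreover have "integrable ?M (\<lambda>x. (indicator A x * w t x)\<^sup>2)"
      unfolding eq by (rule CS(1))
    ultimately show ?thesis
      by (simp add: sqint_le_def)
  qed
  have "sqint_le ?M (\<lambda>x. \<Sum>t<s. indicator A x * w t x)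
      (real (card {..<s}) * (\<Sum>t<s. sqrt (4 * real L * measure ?M A) * (\<Sum>j\<in>R t. (c j)\<^sup>2)))"
    by (rule sqint_le_sum) (rule part)
  also have "(\<lambda>x. \<Sum>t<s. indicator A x * w t x)
      = (\<lambda>x. indicator A x * (\<Sum>j\<in>J. c j * sin (2 * pi * real (\<nu> j) * x)))"
    by (simp only: w_def split sum_distrib_left[symmetric])
  also have "(\<Sum>t<s. sqrt (4 * real L * measure ?M A) * (\<Sum>j\<in>R t. (c j)\<^sup>2))
      = sqrt (4 * real L * measure ?M A) * (\<Sum>j\<in>J. (c j)\<^sup>2)"
    by (simp only: split sum_distrib_left[symmetric])
  finally show ?thesis
    by (simp add: mult.assoc)
qed

section \<open>Averages over small intervals\<close>

text \<open>Centred intervals make the average of a sine a real multiple of the same sine.\<close>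

definition centred_average :: "real \<Rightarrow> (real \<Rightarrow> real) \<Rightarrow> real \<Rightarrow> real" where
  "centred_average h v x = (\<integral>t. indicator {x - h..x + h} t * v t \<partial>lborel) / (2 * h)"

lemma centred_average_sine:
  assumes "h > 0" "\<nu> > 0"
  shows "centred_average h (\<lambda>t. sin (2 * pi * \<nu> * t)) x
    = sin (2 * pi * \<nu> * h) / (2 * pi * \<nu> * h) * sin (2 * pi * \<nu> * x)"
proof -
  let ?w = "2 * pi * \<nu>"
  have "(\<integral>t. sin (?w * t) * indicator {x - h..x + h} t \<partial>lborel)
      = - cos (?w * (x + h)) / ?w - (- cos (?w * (x - h)) / ?w)"
    using assms by (intro integral_FTC_Icc_real) (auto intro!: derivative_eq_intros continuous_intros)
  also have "\<dots> = 2 * sin (?w * x) * sin (?w * h) / ?w"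
    by (simp add: distrib_left right_diff_distrib cos_add cos_diff diff_divide_distrib[symmetric] add_divide_distrib[symmetric])
  finally show ?thesis
    using assms by (simp add: centred_average_def mult.commute field_simps)
qed

lemma abs_sinc_le_inverse: "y > 0 \<Longrightarrow> \<bar>sin y / y\<bar> \<le> 1 / y" for y :: real
  by (simp add: divide_right_mono)

text \<open>Interpolation between the bounds \<open>2\<close> and \<open>y / 2\<close>. The exponent \<open>b\<close> has to be small, as the square of this
bound, at \<open>y\<close> proportional to \<open>m\<close>, is summed against \<open>m powr (- 2 * lam)\<close>.\<close>

lemma abs_one_minus_sinc_le:
  fixes y b :: real
  assumes y: "y > 0" and b: "0 \<le> b" "b \<le> 1"
  shows "\<bar>1 - sin y / y\<bar> \<le> 2 * y powr b"
proof (cases "y \<ge> 1")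
  case True
  have "\<bar>sin y / y\<bar> \<le> 1"
    using abs_sin_x_le_abs_x[of y] y by simp
  moreover have "1 \<le> y powr b"
    using True b by (simp add: ge_one_powr_ge_zero)
  ultimately show ?thesis by linarith
next
  case False
  have "\<bar>sin y - y\<bar> \<le> y\<^sup>2 / 2"
    using Maclaurin_sin_bound[of y 2] y by (simp add: sin_coeff_def numeral_2_eq_2)
  then have "\<bar>sin y - y\<bar> / y \<le> y\<^sup>2 / 2 / y"
    using y by (intro divide_right_mono) auto
  moreover have "1 - sin y / y = - ((sin y - y) / y)"
    using y by (simp add: diff_divide_distrib)
  ultimately have "\<bar>1 - sin y / y\<bar> \<le> y / 2"
    using y by (simp add: power2_eq_square)
  also have "y \<le> y powr b"
    using powr_mono'[of b 1 y] y b False by simp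
  finally show ?thesis using powr_ge_zero[of y b] by linarith
qed

text \<open>Lebesgue's differentiation theorem for intervals starting at the point, rephrased as a limit from the right.\<close>

lemma right_average_tendsto:
  fixes v :: "real \<Rightarrow> real"
  assumes "integrable lborel v"
  shows "AE x in lborel. ((\<lambda>h. (\<integral>t. indicator {x..x + h} t * v t \<partial>lborel) / h) \<longlongrightarrow> v x) (at_right 0)"
proof -
  have si: "set_integrable lborel {a..b} v" for a b
    unfolding set_integrable_def by (rule integrable_mult_indicator[OF _ assms]) simp
  obtain N where N: "negligible N"
    "\<And>x e. \<lbrakk>x \<notin> N; 0 < e\<rbrakk> \<Longrightarrow> \<exists>d>0. \<forall>h. 0 < h \<and> h < d \<longrightarrow>
       norm (integral (cbox x (x + h *\<^sub>R One)) v /\<^sub>R h ^ DIM(real) - v x) < e"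
    using integrable_ccontinuous_explicit[of v] set_borel_integral_eq_integral(1)[OF si] by (auto simp: cbox_interval)
  have "((\<lambda>h. (\<integral>t. indicator {x..x + h} t * v t \<partial>lborel) / h) \<longlongrightarrow> v x) (at_right 0)" if xN: "x \<notin> N" for x
  proof (rule tendstoI)
    fix e :: real assume "e > 0"
    then obtain d where d: "d > 0" "\<And>h. 0 < h \<Longrightarrow> h < d \<Longrightarrow>
       norm (integral (cbox x (x + h *\<^sub>R One)) v /\<^sub>R h ^ DIM(real) - v x) < e"
      using N(2)[OF xN] by blast
    have "dist ((\<integral>t. indicator {x..x + h} t * v t \<partial>lborel) / h) (v x) < e" if h: "0 < h" "h < d" for h
      using d(2)[OF h] set_borel_integral_eq_integral(2)[OF si[of x "x + h"]]
      by (simp add: dist_real_def set_lebesgue_integral_def cbox_interval divide_inverse mult.commute)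
    then show "\<forall>\<^sub>F h in at_right 0. dist ((\<integral>t. indicator {x..x + h} t * v t \<partial>lborel) / h) (v x) < e"
      using d(1) by (auto simp: eventually_at_right_field)
  qed
  moreover have "AE x in lborel. x \<notin> N"
  proof -
    have "AE x in lebesgue. x \<notin> N"
      using N(1) by (intro AE_not_in) (simp add: negligible_iff_null_sets)
    then show ?thesis by (simp add: AE_completion_iff)
  qed
  ultimately show ?thesis
    by (auto elim: eventually_mono)
qed

lemma AE_lborel_uminus:
  assumes "AE x in lborel. P (x :: real)"
  shows "AE x in lborel. P (- x)"
proof -
  obtain N where N: "N \<in> null_sets lborel" "{x. \<not> P x} \<subseteq> N"
    using assms by (auto simp: eventually_ae_filter)
  have "AE x in distr lborel borel uminus. x \<notin> N"
    using N(1) by (subst lborel_distr_uminus) (rule AE_not_in)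
  then have "AE x in lborel. - x \<notin> N"
    using N(1) by (subst (asm) AE_distr_iff) (auto simp: null_sets_def)
  then show ?thesis
    using N(2) by (auto elim: eventually_mono)
qed

text \<open>A centred average is the mean of a right average of \<open>v\<close> at \<open>x\<close> and a right average of the reflected
function at \<open>- x\<close>.\<close>

lemma centred_average_tendsto:
  fixes v :: "real \<Rightarrow> real"
  assumes v: "integrable lborel v"
  shows "AE x in lborel. ((\<lambda>h. centred_average h v x) \<longlongrightarrow> v x) (at_right 0)"
proof -
  have v': "integrable lborel (\<lambda>t. v (- t))"
    using lborel_integrable_real_affine[OF v, of "-1" 0] by simp
  have "AE x in lborel. ((\<lambda>h. (\<integral>t. indicator {x..x + h} t * v (- t) \<partial>lborel) / h) \<longlongrightarrow> v (- x)) (at_right 0)"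
    by (rule right_average_tendsto[OF v'])
  then have left: "AE x in lborel. ((\<lambda>h. (\<integral>t. indicator {- x..- x + h} t * v (- t) \<partial>lborel) / h) \<longlongrightarrow> v (- (- x))) (at_right 0)"
    by (rule AE_lborel_uminus)
  show ?thesis
    using right_average_tendsto[OF v] left
  proof eventually_elim
    case (elim x)
    have "((\<lambda>h. ((\<integral>t. indicator {x..x + h} t * v t \<partial>lborel) / h
        + (\<integral>t. indicator {- x..- x + h} t * v (- t) \<partial>lborel) / h) / 2) \<longlongrightarrow> (v x + v (- (- x))) / 2) (at_right 0)"
      by (intro tendsto_intros elim) simp
    moreover have "\<forall>\<^sub>F h in at_right 0. ((\<integral>t. indicator {x..x + h} t * v t \<partial>lborel) / h
        + (\<integral>t. indicator {- x..- x + h} t * v (- t) \<partial>lborel) / h) / 2 = centred_average h v x"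
      unfolding eventually_at_right_field
    proof (intro exI[of _ 1] conjI allI impI)
      fix h :: real assume "0 < h"
      have ii: "integrable lborel (\<lambda>t. indicator {a..b} t * v t)" for a b :: real
        using integrable_mult_indicator[OF _ v, of "{a..b}"] by simp
      have "(\<integral>t. indicator {- x..- x + h} t * v (- t) \<partial>lborel) = (\<integral>t. indicator {x - h..x} t * v t \<partial>lborel)"
        by (subst lborel_integral_real_affine[where c = "-1" and t = 0])
          (auto intro!: Bochner_Integration.integral_cong simp: indicator_def)
      then have "(\<integral>t. indicator {x..x + h} t * v t \<partial>lborel) + (\<integral>t. indicator {- x..- x + h} t * v (- t) \<partial>lborel)
          = (\<integral>t. indicator {x..x + h} t * v t + indicator {x - h..x} t * v t \<partial>lborel)"
        by (simp add: Bochner_Integration.integral_add[OF ii ii])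
      also have "\<dots> = (\<integral>t. indicator {x - h..x + h} t * v t \<partial>lborel)"
        using \<open>0 < h\<close> AE_lborel_singleton[of x]
        by (intro integral_cong_AE) (use v in \<open>auto simp: indicator_def\<close>)
      finally show "((\<integral>t. indicator {x..x + h} t * v t \<partial>lborel) / h
          + (\<integral>t. indicator {- x..- x + h} t * v (- t) \<partial>lborel) / h) / 2 = centred_average h v x"
        by (simp add: centred_average_def add_divide_distrib[symmetric] mult.commute)
    qed simp
    ultimately show ?case
      by (auto intro: Lim_transform_eventually)
  qed
qed

lemma sqint_le_indicator_sym_interval:
  assumes "A \<in> sets borel"
  shows "sqint_le (sym_interval L) (indicator A) (2 * real L)"
proof (rule sqint_le_bound[OF sqint_le_one[OF finite_measure_sym_interval, unfolded measure_sym_interval]])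
  show "indicator A \<in> borel_measurable (sym_interval L)"
    using assms by (intro measurable_sym_interval) simp
qed (simp add: indicator_def)

text \<open>For a fixed radius the average is continuous in the \<open>L\<^sup>2\<close> norm, by Cauchy-Schwarz. The bound degenerates as
\<open>h\<close> tends to \<open>0\<close>, but it is only used to pass to limits under the average.\<close>

lemma abs_centred_average_le:
  assumes v: "sqint_le (sym_interval (Suc L)) v B" and x: "x \<in> {- real L..real L}" and h: "0 < h" "h \<le> 1"
  shows "\<bar>centred_average h v x\<bar> \<le> sqrt (2 * real (Suc L) * B) / (2 * h)"
proof -
  let ?M = "sym_interval (Suc L)" and ?A = "{x - h..x + h}"
  have ind: "sqint_le ?M (indicator ?A) (2 * real (Suc L))"
    by (rule sqint_le_indicator_sym_interval) simp
  have "(\<integral>t. indicator ?A t * v t \<partial>lborel) = (\<integral>t. indicator ?A t * v t \<partial>?M)"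
    unfolding integral_sym_interval
    using x h by (intro Bochner_Integration.integral_cong) (auto simp: indicator_def)
  then show ?thesis
    using sqint_le_Cauchy_Schwarz(3)[OF ind v] h
    by (simp add: centred_average_def divide_right_mono)
qed

lemma centred_average_integrable:
  assumes v: "sqint_le (sym_interval (Suc L)) v B" and x: "x \<in> {- real L..real L}" and h: "0 < h" "h \<le> 1"
  shows "integrable lborel (\<lambda>t. indicator {x - h..x + h} t * v t)"
proof -
  let ?M = "sym_interval (Suc L)" and ?A = "{x - h..x + h}"
  have ind: "sqint_le ?M (indicator ?A) (2 * real (Suc L))"
    by (rule sqint_le_indicator_sym_interval) simp
  have "(\<lambda>t. indicator ?A t * v t) = (\<lambda>t. indicator {- real (Suc L)..real (Suc L)} t * (indicator ?A t * v t))"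
    using x h by (auto simp: indicator_def)
  then show ?thesis
    using sqint_le_Cauchy_Schwarz(1)[OF ind v] unfolding integrable_sym_interval by metis
qed

lemma centred_average_diff:
  assumes "sqint_le (sym_interval (Suc L)) v B" "sqint_le (sym_interval (Suc L)) w C"
    "x \<in> {- real L..real L}" "0 < h" "h \<le> 1"
  shows "centred_average h (\<lambda>t. v t - w t) x = centred_average h v x - centred_average h w x"
  unfolding centred_average_def right_diff_distrib
  by (subst Bochner_Integration.integral_diff)
    (use assms in \<open>auto intro: centred_average_integrable simp: diff_divide_distrib\<close>)

lemma centred_average_sum:
  assumes "\<And>k. k \<in> K \<Longrightarrow> sqint_le (sym_interval (Suc L)) (v k) (B k)"
    "x \<in> {- real L..real L}" "0 < h" "h \<le> 1"
  shows "centred_average h (\<lambda>t. \<Sum>k\<in>K. c k * v k t) x = (\<Sum>k\<in>K. c k * centred_average h (v k) x)"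
proof -
  have "(\<integral>t. indicator {x - h..x + h} t * (\<Sum>k\<in>K. c k * v k t) \<partial>lborel)
      = (\<integral>t. (\<Sum>k\<in>K. c k * (indicator {x - h..x + h} t * v k t)) \<partial>lborel)"
    by (simp add: sum_distrib_left mult.left_commute)
  also have "\<dots> = (\<Sum>k\<in>K. c k * (\<integral>t. indicator {x - h..x + h} t * v k t \<partial>lborel))"
    by (subst Bochner_Integration.integral_sum) (use assms in \<open>auto intro!: centred_average_integrable\<close>)
  finally show ?thesis
    by (simp add: centred_average_def sum_divide_distrib)
qed

lemma centred_average_LIMSEQ:
  assumes v: "sqint_le (sym_interval (Suc L)) v C" and w: "\<And>K. sqint_le (sym_interval (Suc L)) (w K) (D K)"
    and diff: "\<And>K. sqint_le (sym_interval (Suc L)) (\<lambda>t. v t - w K t) (B K)" and B: "B \<longlonglongrightarrow> 0"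
    and x: "x \<in> {- real L..real L}" and h: "0 < h" "h \<le> 1"
  shows "(\<lambda>K. centred_average h (w K) x) \<longlonglongrightarrow> centred_average h v x"
proof -
  have "(\<lambda>K. centred_average h v x - centred_average h (w K) x) \<longlonglongrightarrow> 0"
  proof (rule Lim_null_comparison)
    show "\<forall>\<^sub>F K in sequentially. norm (centred_average h v x - centred_average h (w K) x)
        \<le> sqrt (2 * real (Suc L) * B K) / (2 * h)"
      using abs_centred_average_le[OF diff x h] centred_average_diff[OF v w x h] by simp
    have "(\<lambda>K. sqrt (2 * real (Suc L) * B K) / (2 * h)) \<longlonglongrightarrow> sqrt (2 * real (Suc L) * 0) / (2 * h)"
      using h by (intro tendsto_intros B) simp
    then show "(\<lambda>K. sqrt (2 * real (Suc L) * B K) / (2 * h)) \<longlonglongrightarrow> 0" by simp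
  qed
  from tendsto_diff[OF tendsto_const[of "centred_average h v x"] this] show ?thesis
    by simp
qed

section \<open>The Davenport function in mean square\<close>

text \<open>The value of the Riemann zeta function at \<open>2 * lam\<close>, which is twice the mean square of the Davenport function.\<close>

definition zeta2 :: "real \<Rightarrow> real" where
  "zeta2 lam = (\<Sum>m. (1 / real (Suc m) powr lam)\<^sup>2)"

lemma powr_square_Suc: "(1 / real (Suc m) powr lam)\<^sup>2 = real (Suc m) powr (- 2 * lam)"
  by (simp add: power_divide powr_minus_divide powr_add[symmetric] power2_eq_square)

lemma summable_powr_Suc: "s < - 1 \<Longrightarrow> summable (\<lambda>m. real (Suc m) powr s)"
  using summable_Suc_iff[of "\<lambda>m. real m powr s"] summable_real_powr_iff[of s] by simp

lemma summable_zeta2: "lam > 1 / 2 \<Longrightarrow> summable (\<lambda>m. (1 / real (Suc m) powr lam)\<^sup>2)"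
  unfolding powr_square_Suc by (rule summable_powr_Suc) simp

lemma zeta2_partial_le: "lam > 1 / 2 \<Longrightarrow> finite I \<Longrightarrow> (\<Sum>m\<in>I. (1 / real (Suc m) powr lam)\<^sup>2) \<le> zeta2 lam"
  unfolding zeta2_def by (rule sum_le_suminf[OF summable_zeta2]) auto

lemma zeta2_nonneg: "lam > 1 / 2 \<Longrightarrow> zeta2 lam \<ge> 0"
  unfolding zeta2_def by (rule suminf_nonneg[OF summable_zeta2]) auto

lemma sqint_le_dilated_sine_polynomial:
  assumes "finite I" "n > 0"
  shows "sqint_le (sym_interval L) (\<lambda>x. \<Sum>m\<in>I. c m * sin (2 * pi * real (Suc m) * (real n * x)))
    (2 * real L * (\<Sum>m\<in>I. (c m)\<^sup>2))"
proof -
  have "inj_on (\<lambda>m. Suc m * n) I"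
    using assms(2) by (auto simp: inj_on_def)
  from sqint_le_sine_polynomial[OF assms(1) this, of L c] show ?thesis
    by (simp only: of_nat_mult mult.assoc)
qed

lemma sqint_le_davenport_partial_diff:
  assumes "n > 0" "M \<le> K"
  shows "sqint_le (sym_interval L) (\<lambda>x. davenport_partial lam K (real n * x) - davenport_partial lam M (real n * x))
    (2 * real L * (\<Sum>m\<in>{M..<K}. (1 / real (Suc m) powr lam)\<^sup>2))"
proof -
  have "davenport_partial lam K y - davenport_partial lam M y
      = (\<Sum>m\<in>{M..<K}. (1 / real (Suc m) powr lam) * sin (2 * pi * real (Suc m) * y))" for y
    using sum_diff_nat_ivl[of 0 M K "\<lambda>m. sin (2 * pi * real (Suc m) * y) / real (Suc m) powr lam"] assms(2)
    by (simp add: davenport_partial_def atLeast0LessThan)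
  then show ?thesis
    using sqint_le_dilated_sine_polynomial[of "{M..<K}" n L "\<lambda>m. 1 / real (Suc m) powr lam"] assms(1) by simp
qed

definition zeta2_tail :: "real \<Rightarrow> nat \<Rightarrow> real" where
  "zeta2_tail lam M = zeta2 lam - (\<Sum>m<M. (1 / real (Suc m) powr lam)\<^sup>2)"

lemma zeta2_tail_0 [simp]: "zeta2_tail lam 0 = zeta2 lam"
  by (simp add: zeta2_tail_def)

lemma zeta2_tail_LIMSEQ: "lam > 1 / 2 \<Longrightarrow> (\<lambda>M. c * zeta2_tail lam M) \<longlonglongrightarrow> 0"
proof -
  assume "lam > 1 / 2"
  then have "(\<lambda>M. zeta2 lam - (\<Sum>m<M. (1 / real (Suc m) powr lam)\<^sup>2)) \<longlonglongrightarrow> zeta2 lam - zeta2 lam"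
    unfolding zeta2_def by (intro tendsto_intros summable_LIMSEQ summable_zeta2)
  then show ?thesis
    unfolding zeta2_tail_def by (auto intro: tendsto_mult_right_zero)
qed

lemma sqint_le_davenport_tail:
  assumes lam: "lam > 1 / 2" and n: "n > 0"
  shows "sqint_le (sym_interval L) (\<lambda>x. davenport lam (real n * x) - davenport_partial lam M (real n * x))
    (2 * real L * zeta2_tail lam M)"
proof (rule sqint_le_limit_pointwise)
  show "(\<lambda>K. davenport_partial lam K (real n * x) - davenport_partial lam M (real n * x))
      \<longlonglongrightarrow> davenport lam (real n * x) - davenport_partial lam M (real n * x)" for x
    using lam by (intro tendsto_intros davenport_partial_LIMSEQ) simp
  show "sqint_le (sym_interval L) (\<lambda>x. davenport_partial lam K (real n * x) - davenport_partial lam M (real n * x))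
      (2 * real L * zeta2_tail lam M)" if "K \<ge> M" for K
  proof (rule sqint_le_mono[OF sqint_le_davenport_partial_diff[OF n that]])
    have "(\<Sum>m\<in>{M..<K}. (1 / real (Suc m) powr lam)\<^sup>2) = (\<Sum>m<K. (1 / real (Suc m) powr lam)\<^sup>2) - (\<Sum>m<M. (1 / real (Suc m) powr lam)\<^sup>2)"
      using sum_diff_nat_ivl[of 0 M K "\<lambda>m. (1 / real (Suc m) powr lam)\<^sup>2"] that by (simp add: atLeast0LessThan)
    also have "\<dots> \<le> zeta2_tail lam M"
      using zeta2_partial_le[OF lam, of "{..<K}"] by (simp add: zeta2_tail_def)
    finally show "2 * real L * (\<Sum>m\<in>{M..<K}. (1 / real (Suc m) powr lam)\<^sup>2) \<le> 2 * real L * zeta2_tail lam M"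
      by (simp add: mult_left_mono)
  qed
qed

lemma sqint_le_davenport:
  assumes "lam > 1 / 2" "n > 0"
  shows "sqint_le (sym_interval L) (\<lambda>x. davenport lam (real n * x)) (2 * real L * zeta2 lam)"
  using sqint_le_davenport_tail[OF assms, of L 0] by (simp add: davenport_partial_def)

lemma sqint_le_davenport_partial:
  assumes "lam > 1 / 2" "n > 0"
  shows "sqint_le (sym_interval L) (\<lambda>x. davenport_partial lam M (real n * x)) (2 * real L * zeta2 lam)"
proof (rule sqint_le_mono)
  show "sqint_le (sym_interval L) (\<lambda>x. davenport_partial lam M (real n * x)) (2 * real L * (\<Sum>m\<in>{0..<M}. (1 / real (Suc m) powr lam)\<^sup>2))"
    using sqint_le_davenport_partial_diff[of n 0 M L lam] assms by (simp add: davenport_partial_def)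
qed (use zeta2_partial_le[OF assms(1), of "{0..<M}"] in \<open>simp add: mult_left_mono\<close>)

lemma integral_mult_LIMSEQ:
  assumes w: "\<And>K. sqint_le M (w K) D" and u: "sqint_le M u D'" and diff: "\<And>K. sqint_le M (\<lambda>x. u x - w K x) (B K)"
    and B: "B \<longlonglongrightarrow> 0" and v: "sqint_le M v C"
  shows "(\<lambda>K. \<integral>x. w K x * v x \<partial>M) \<longlonglongrightarrow> (\<integral>x. u x * v x \<partial>M)"
proof -
  have "(\<lambda>K. (\<integral>x. u x * v x \<partial>M) - (\<integral>x. w K x * v x \<partial>M)) \<longlonglongrightarrow> 0"
  proof (rule Lim_null_comparison)
    have "(\<integral>x. u x * v x \<partial>M) - (\<integral>x. w K x * v x \<partial>M) = (\<integral>x. (u x - w K x) * v x \<partial>M)" for K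
      using sqint_le_Cauchy_Schwarz(1)[OF u v] sqint_le_Cauchy_Schwarz(1)[OF w v]
      by (simp add: left_diff_distrib)
    then show "\<forall>\<^sub>F K in sequentially. norm ((\<integral>x. u x * v x \<partial>M) - (\<integral>x. w K x * v x \<partial>M)) \<le> sqrt (B K * C)"
      using sqint_le_Cauchy_Schwarz(3)[OF diff v] by simp
    have "(\<lambda>K. sqrt (B K * C)) \<longlonglongrightarrow> sqrt (0 * C)"
      by (intro tendsto_intros B)
    then show "(\<lambda>K. sqrt (B K * C)) \<longlonglongrightarrow> 0" by simp
  qed
  from tendsto_diff[OF tendsto_const[of "\<integral>x. u x * v x \<partial>M"] this] show ?thesis
    by simp
qed

lemma sqint_le_sine:
  assumes "N > 0"
  shows "sqint_le (sym_interval L) (\<lambda>x. sin (2 * pi * real N * x)) (2 * real L)"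
  using sqint_le_sine_polynomial[of "{N}" id L "\<lambda>_. 1"] by simp

text \<open>The frequency \<open>N\<close> occurs in \<open>f (n * x)\<close> exactly when \<open>N = m * n\<close> for some \<open>m\<close>, with coefficient
\<open>m powr (- lam)\<close>.\<close>

lemma davenport_sine_coefficient:
  assumes lam: "lam > 1 / 2" and n: "n > 0" and N: "N > 0"
  shows "(\<integral>x. davenport lam (real n * x) * sin (2 * pi * real N * x) \<partial>sym_interval L)
    = (if n dvd N then real L * (real n / real N) powr lam else 0)"
proof -
  let ?M = "sym_interval L"
  have "(\<lambda>K. \<integral>x. davenport_partial lam K (real n * x) * sin (2 * pi * real N * x) \<partial>?M)
      \<longlonglongrightarrow> (\<integral>x. davenport lam (real n * x) * sin (2 * pi * real N * x) \<partial>?M)"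
    by (rule integral_mult_LIMSEQ[OF sqint_le_davenport_partial[OF lam n] sqint_le_davenport[OF lam n]
          sqint_le_davenport_tail[OF lam n] zeta2_tail_LIMSEQ[OF lam] sqint_le_sine[OF N]])
  moreover have "(\<lambda>K. \<integral>x. davenport_partial lam K (real n * x) * sin (2 * pi * real N * x) \<partial>?M)
      \<longlonglongrightarrow> (if n dvd N then real L * (real n / real N) powr lam else 0)"
  proof (rule tendsto_eventually, unfold eventually_sequentially, intro exI allI impI)
    fix K assume K: "N \<le> K"
    have "(\<integral>x. davenport_partial lam K (real n * x) * sin (2 * pi * real N * x) \<partial>?M)
        = (\<integral>x. (\<Sum>m<K. 1 / real (Suc m) powr lam * (sin (2 * pi * real (Suc m * n) * x) * sin (2 * pi * real N * x))) \<partial>?M)"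
      by (simp add: davenport_partial_def sum_distrib_right mult.assoc of_nat_mult del: of_nat_Suc mult_Suc)
    also have "\<dots> = (\<Sum>m<K. 1 / real (Suc m) powr lam * (\<integral>x. sin (2 * pi * real (Suc m * n) * x) * sin (2 * pi * real N * x) \<partial>?M))"
      by (subst Bochner_Integration.integral_sum)
        (auto intro!: continuous_integrable_sym_interval continuous_intros simp del: of_nat_Suc of_nat_mult)
    also have "\<dots> = (\<Sum>m<K. if Suc m * n = N then real L / real (Suc m) powr lam else 0)"
      using n N by (intro sum.cong refl) (simp add: integral_sin_sin_sym_interval del: of_nat_Suc of_nat_mult mult_Suc)
    also have "\<dots> = (if n dvd N then real L * (real n / real N) powr lam else 0)"
    proof (cases "n dvd N")
      case True
      then obtain q where q: "N = q * n" by (metis dvdE mult.commute)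
      then obtain m where m: "q = Suc m" using N by (cases q) auto
      have "m < K" using K q m n N by (metis Suc_le_lessD le_trans mult_le_mono2 mult_1_right Suc_leI One_nat_def)
      have "(\<Sum>i<K. if Suc i * n = N then real L / real (Suc i) powr lam else 0)
          = (\<Sum>i<K. if i = m then real L / real (Suc m) powr lam else 0)"
        using n by (intro sum.cong refl) (auto simp: q m simp del: mult_Suc)
      also have "\<dots> = real L / real (Suc m) powr lam"
        using \<open>m < K\<close> by simp
      also have "\<dots> = real L * (real n / real N) powr lam"
        using n by (simp add: q m powr_divide powr_mult del: of_nat_Suc mult_Suc)
      finally show ?thesis using True by simp
    next
      case False
      then have "Suc i * n \<noteq> N" for i by (metis dvd_triv_right)
      then show ?thesis using False by simp
    qed
    finally show "(\<integral>x. davenport_partial lam K (real n * x) * sin (2 * pi * real N * x) \<partial>?M)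
        = (if n dvd N then real L * (real n / real N) powr lam else 0)" .
  qed
  ultimately show ?thesis
    by (rule LIMSEQ_unique)
qed

text \<open>Expanding the second factor into sines reduces the integral to the coefficients of the first: the \<open>m\<close>-th term
is at most \<open>m powr (- 2 * lam)\<close> times the constant \<open>L * (p / r) powr lam\<close>. The bound is of interest for \<open>p \<le> r\<close>;
the other case follows by symmetry.\<close>

lemma davenport_inner_product_le:
  assumes lam: "lam > 1 / 2" and p: "p > 0" and r: "r > 0"
  shows "\<bar>\<integral>x. davenport lam (real p * x) * davenport lam (real r * x) \<partial>sym_interval L\<bar>
    \<le> real L * zeta2 lam * (real p / real r) powr lam"
proof -
  let ?M = "sym_interval L"
  let ?I = "\<lambda>K. \<integral>x. davenport_partial lam K (real r * x) * davenport lam (real p * x) \<partial>?M"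
  have "?I \<longlonglongrightarrow> (\<integral>x. davenport lam (real r * x) * davenport lam (real p * x) \<partial>?M)"
    by (rule integral_mult_LIMSEQ[OF sqint_le_davenport_partial[OF lam r] sqint_le_davenport[OF lam r]
          sqint_le_davenport_tail[OF lam r] zeta2_tail_LIMSEQ[OF lam] sqint_le_davenport[OF lam p]])
  then have lim: "(\<lambda>K. \<bar>?I K\<bar>) \<longlonglongrightarrow> \<bar>\<integral>x. davenport lam (real p * x) * davenport lam (real r * x) \<partial>?M\<bar>"
    by (auto intro: tendsto_rabs simp: mult.commute)
  have "\<bar>?I K\<bar> \<le> real L * zeta2 lam * (real p / real r) powr lam" for K
  proof -
    let ?c = "\<lambda>m. \<integral>x. davenport lam (real p * x) * sin (2 * pi * real (Suc m * r) * x) \<partial>?M"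
    have Npos: "0 < Suc m * r" for m using r by simp
    have "?I K = (\<integral>x. (\<Sum>m<K. 1 / real (Suc m) powr lam * (davenport lam (real p * x) * sin (2 * pi * real (Suc m * r) * x))) \<partial>?M)"
      by (simp add: davenport_partial_def sum_distrib_left sum_distrib_right mult_ac of_nat_mult del: of_nat_Suc mult_Suc mult_Suc_right)
    also have "\<dots> = (\<Sum>m<K. 1 / real (Suc m) powr lam * ?c m)"
      using sqint_le_Cauchy_Schwarz(1)[OF sqint_le_davenport[OF lam p] sqint_le_sine[OF Npos]]
      by (subst Bochner_Integration.integral_sum) (auto simp del: of_nat_Suc of_nat_mult mult_Suc)
    finally have "\<bar>?I K\<bar> \<le> (\<Sum>m<K. \<bar>1 / real (Suc m) powr lam * ?c m\<bar>)"
      by (simp only: sum_abs)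
    also have "\<dots> \<le> (\<Sum>m<K. (1 / real (Suc m) powr lam)\<^sup>2 * (real L * (real p / real r) powr lam))"
    proof (rule sum_mono)
      fix m
      have "(real p / real (Suc m * r)) powr lam = 1 / real (Suc m) powr lam * (real p / real r) powr lam"
        using p r by (simp add: powr_divide powr_mult del: of_nat_Suc mult_Suc)
      then have "\<bar>?c m\<bar> \<le> real L * (1 / real (Suc m) powr lam * (real p / real r) powr lam)"
        unfolding davenport_sine_coefficient[OF lam p Npos] by auto
      then have "1 / real (Suc m) powr lam * \<bar>?c m\<bar>
          \<le> 1 / real (Suc m) powr lam * (real L * (1 / real (Suc m) powr lam * (real p / real r) powr lam))"
        by (rule mult_left_mono) simp
      then show "\<bar>1 / real (Suc m) powr lam * ?c m\<bar> \<le> (1 / real (Suc m) powr lam)\<^sup>2 * (real L * (real p / real r) powr lam)"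
        by (simp only: abs_mult power2_eq_square) (simp add: mult_ac)
    qed
    also have "\<dots> = (\<Sum>m<K. (1 / real (Suc m) powr lam)\<^sup>2) * (real L * (real p / real r) powr lam)"
      by (simp only: sum_distrib_right)
    also have "\<dots> \<le> zeta2 lam * (real L * (real p / real r) powr lam)"
      using zeta2_partial_le[OF lam, of "{..<K}"] by (intro mult_right_mono) auto
    finally show ?thesis by (simp add: mult_ac)
  qed
  then show ?thesis
    by (intro LIMSEQ_le_const2[OF lim]) auto
qed

section \<open>Lacunary series of dilated Davenport functions\<close>

locale lacunary_davenport =
  fixes lam :: real and n :: "nat \<Rightarrow> nat" and q :: real
  assumes lam: "lam > 1 / 2" and n_pos: "\<And>k. n k > 0" and q: "q > 1"
    and ratio: "\<And>k. real (n (Suc k)) / real (n k) \<ge> q"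
begin

abbreviation F :: "nat \<Rightarrow> real \<Rightarrow> real" where
  "F k x \<equiv> davenport lam (real (n k) * x)"

text \<open>If two dilation factors are at distance \<open>g\<close> in the sequence, then the \<open>b\<close>-th power of the smaller one divided
by the larger one is at most \<open>decay b ^ g\<close>.\<close>

definition decay :: "real \<Rightarrow> real" where
  "decay b = q powr (- b)"

lemma decay: "b > 0 \<Longrightarrow> 0 < decay b" "b > 0 \<Longrightarrow> decay b < 1"
  using q by (auto simp: decay_def powr_less_one)

lemma decay_power: "decay b ^ g = ((1 / q) ^ g) powr b"
  using q by (simp add: decay_def powr_minus_divide powr_power powr_powr powr_divide mult.commute flip: powr_realpow)

lemma growth: "j \<le> k \<Longrightarrow> real (n j) * q ^ gap j k \<le> real (n k)"
proof (induction k rule: dec_induct)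
  case (step k)
  have "real (n j) * q ^ gap j (Suc k) = (real (n j) * q ^ gap j k) * q"
    using step by (simp add: gap_def Suc_diff_le)
  also have "\<dots> \<le> real (n k) * q"
    using step q by (intro mult_right_mono) auto
  also have "\<dots> \<le> real (n (Suc k))"
    using ratio[of k] n_pos[of k] by (simp add: field_simps)
  finally show ?case .
qed simp

lemma quotient_le: "j \<le> k \<Longrightarrow> real (n j) / real (n k) \<le> (1 / q) ^ gap j k"
  using growth[of j k] n_pos[of k] q by (simp add: field_simps power_divide)

lemma filterlim_n: "filterlim (\<lambda>N. real (n N)) at_top sequentially"
proof (rule filterlim_at_top_mono)
  show "filterlim (\<lambda>N. q ^ N) at_top sequentially"
    using q by (intro filterlim_at_infinity_imp_filterlim_at_top filterlim_realpow_sequentially_gt1) auto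
  show "\<forall>\<^sub>F N in sequentially. q ^ N \<le> real (n N)"
  proof (intro always_eventually allI)
    fix N
    have "1 * q ^ N \<le> real (n 0) * q ^ N"
      using n_pos[of 0] q by (intro mult_right_mono) auto
    then show "q ^ N \<le> real (n N)"
      using growth[of 0 N] by (simp add: gap_def)
  qed
qed

lemma inner_product_le:
  "\<bar>\<integral>x. F j x * F k x \<partial>sym_interval L\<bar> \<le> real L * zeta2 lam * decay lam ^ gap j k"
proof -
  have *: "\<bar>\<integral>x. F j x * F k x \<partial>sym_interval L\<bar> \<le> real L * zeta2 lam * decay lam ^ gap j k" if "j \<le> k" for j k
  proof -
    have "\<bar>\<integral>x. F j x * F k x \<partial>sym_interval L\<bar> \<le> real L * zeta2 lam * (real (n j) / real (n k)) powr lam"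
      by (rule davenport_inner_product_le[OF lam n_pos n_pos])
    also have "\<dots> \<le> real L * zeta2 lam * decay lam ^ gap j k"
      unfolding decay_power using quotient_le[OF that] lam zeta2_nonneg[OF lam]
      by (intro mult_left_mono powr_mono2) auto
    finally show ?thesis .
  qed
  show ?thesis
    using *[of j k] *[of k j] by (cases "j \<le> k") (auto simp: gap_commute mult.commute)
qed

definition riesz_const :: "nat \<Rightarrow> real" where
  "riesz_const L = real L * zeta2 lam * (2 / (1 - decay lam))"

lemma riesz_const_nonneg: "riesz_const L \<ge> 0"
  using decay(2)[of lam] lam zeta2_nonneg[OF lam] by (simp add: riesz_const_def)

lemma F_sqint: "sqint_le (sym_interval L) (F k) (2 * real L * zeta2 lam)"
  by (rule sqint_le_davenport[OF lam n_pos])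

text \<open>The Gram matrix of the functions \<open>F k\<close> decays geometrically away from the diagonal, so Schur's test applies.\<close>

lemma riesz_upper:
  assumes "finite K"
  shows "sqint_le (sym_interval L) (\<lambda>x. \<Sum>k\<in>K. a k * F k x) (riesz_const L * (\<Sum>k\<in>K. (a k)\<^sup>2))"
proof -
  let ?M = "sym_interval L"
  have int: "integrable ?M (\<lambda>x. F j x * F k x)" for j k
    by (rule sqint_le_Cauchy_Schwarz(1)[OF F_sqint F_sqint])
  have sq: "(\<Sum>k\<in>K. a k * F k x)\<^sup>2 = (\<Sum>j\<in>K. \<Sum>k\<in>K. a j * a k * (F j x * F k x))" for x
    unfolding power2_eq_square sum_product by (simp add: mult_ac)
  have "(\<integral>x. (\<Sum>k\<in>K. a k * F k x)\<^sup>2 \<partial>?M) = (\<Sum>j\<in>K. \<Sum>k\<in>K. a j * a k * (\<integral>x. F j x * F k x \<partial>?M))"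
    unfolding sq by (simp add: int)
  also have "\<dots> \<le> (\<Sum>j\<in>K. \<Sum>k\<in>K. real L * zeta2 lam * (\<bar>a j\<bar> * \<bar>a k\<bar> * decay lam ^ gap j k))"
  proof (intro sum_mono)
    fix j k
    have "a j * a k * (\<integral>x. F j x * F k x \<partial>?M) \<le> \<bar>a j\<bar> * \<bar>a k\<bar> * \<bar>\<integral>x. F j x * F k x \<partial>?M\<bar>"
      using abs_ge_self[of "a j * a k * (\<integral>x. F j x * F k x \<partial>?M)"] by (simp only: abs_mult)
    also have "\<dots> \<le> \<bar>a j\<bar> * \<bar>a k\<bar> * (real L * zeta2 lam * decay lam ^ gap j k)"
      by (intro mult_left_mono inner_product_le) auto
    finally show "a j * a k * (\<integral>x. F j x * F k x \<partial>?M) \<le> real L * zeta2 lam * (\<bar>a j\<bar> * \<bar>a k\<bar> * decay lam ^ gap j k)"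
      by (simp add: mult_ac)
  qed
  also have "\<dots> = real L * zeta2 lam * (\<Sum>j\<in>K. \<Sum>k\<in>K. \<bar>a j\<bar> * \<bar>a k\<bar> * decay lam ^ gap j k)"
    by (simp add: sum_distrib_left)
  also have "\<dots> \<le> real L * zeta2 lam * (2 / (1 - decay lam) * (\<Sum>k\<in>K. (a k)\<^sup>2))"
    using decay[of lam] lam zeta2_nonneg[OF lam] assms by (intro mult_left_mono schur_gap) auto
  finally have "(\<integral>x. (\<Sum>k\<in>K. a k * F k x)\<^sup>2 \<partial>?M) \<le> riesz_const L * (\<Sum>k\<in>K. (a k)\<^sup>2)"
    by (simp add: riesz_const_def mult_ac)
  moreover have "integrable ?M (\<lambda>x. (\<Sum>k\<in>K. a k * F k x)\<^sup>2)"
    unfolding sq by (intro Bochner_Integration.integrable_sum integrable_mult_right int)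
  moreover have "(\<lambda>x. \<Sum>k\<in>K. a k * F k x) \<in> borel_measurable ?M"
    by (intro borel_measurable_sum borel_measurable_times borel_measurable_const sqint_le_measurable[OF F_sqint])
  ultimately show ?thesis
    by (simp add: sqint_le_def)
qed

section \<open>Square summability implies almost everywhere convergence\<close>

text \<open>An \<open>L\<^sup>2\<close> Hoelder exponent of the Davenport function: any positive number below \<open>lam - 1 / 2\<close> would do, capped at \<open>1\<close>
for \<open>abs_one_minus_sinc_le\<close>.\<close>

definition smoothness :: real where
  "smoothness = min 1 ((lam - 1 / 2) / 2)"

lemma smoothness: "0 < smoothness" "smoothness \<le> 1" "2 * smoothness - 2 * lam < - 1"
  using lam by (auto simp: smoothness_def min_def field_simps)

text \<open>The sine of frequency \<open>m * n k\<close>, averaged at radius \<open>1 / n N\<close>, is multiplied by the sinc of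
\<open>y = 2 * pi * m * n k / n N\<close>. For \<open>k < N\<close> the argument is small up to the factor \<open>m\<close> and the multiplier is close
to \<open>1\<close>; for \<open>k \<ge> N\<close> the argument is large and the multiplier is close to \<open>0\<close>.\<close>

lemma multiplier_le:
  "\<bar>(if k < N then 1 else 0) - sin (2 * pi * (real (Suc m) * real (n k)) * (1 / real (n N)))
        / (2 * pi * (real (Suc m) * real (n k)) * (1 / real (n N)))\<bar>
    \<le> 4 * pi * real (Suc m) powr smoothness * decay smoothness ^ gap N k"
proof -
  let ?b = smoothness
  define y where "y = 2 * pi * (real (Suc m) * real (n k)) * (1 / real (n N))"
  define u where "u = (1 / q) ^ gap N k"
  have u: "0 < u" "u \<le> 1"
    using q by (auto simp: u_def power_le_one)
  have y: "y > 0"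
    using n_pos[of k] n_pos[of N] by (simp add: y_def)
  have m1: "1 \<le> real (Suc m) powr ?b"
    using smoothness by (intro ge_one_powr_ge_zero) auto
  have pi: "2 * pi \<ge> 1" using pi_gt3 by simp
  have "\<bar>(if k < N then 1 else 0) - sin y / y\<bar> \<le> 4 * pi * real (Suc m) powr ?b * u powr ?b"
  proof (cases "k < N")
    case True
    have "real (n k) / real (n N) \<le> u"
      using quotient_le[of k N] True by (simp add: u_def gap_commute)
    then have "2 * pi * real (Suc m) * (real (n k) / real (n N)) \<le> 2 * pi * real (Suc m) * u"
      by (intro mult_left_mono) auto
    then have "y \<le> 2 * pi * real (Suc m) * u"
      by (simp add: y_def mult_ac del: of_nat_Suc)
    then have "y powr ?b \<le> (2 * pi * real (Suc m) * u) powr ?b"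
      using y smoothness by (intro powr_mono2) auto
    also have "\<dots> = (2 * pi) powr ?b * (real (Suc m) powr ?b * u powr ?b)"
      using u by (simp add: powr_mult mult.assoc del: of_nat_Suc)
    also have "\<dots> \<le> (2 * pi) * (real (Suc m) powr ?b * u powr ?b)"
      using powr_mono[of ?b 1 "2 * pi"] smoothness pi by (intro mult_right_mono) auto
    finally have "y powr ?b \<le> (2 * pi) * (real (Suc m) powr ?b * u powr ?b)" .
    moreover have "\<bar>1 - sin y / y\<bar> \<le> 2 * y powr ?b"
      using y smoothness by (intro abs_one_minus_sinc_le) auto
    ultimately show ?thesis using True by (simp add: mult_ac)
  next
    case False
    have "real (n N) / real (n k) \<le> u"
      using quotient_le[of N k] False by (simp add: u_def)
    have "\<bar>sin y / y\<bar> \<le> 1 / y"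
      using y by (rule abs_sinc_le_inverse)
    also have "1 / y = (1 / (2 * pi * real (Suc m))) * (real (n N) / real (n k))"
      by (simp add: y_def del: of_nat_Suc)
    also have "\<dots> \<le> 1 * (real (n N) / real (n k))"
    proof (intro mult_right_mono)
      have "1 * 1 \<le> 2 * pi * real (Suc m)"
        using pi by (intro mult_mono) auto
      then show "1 / (2 * pi * real (Suc m)) \<le> 1" by simp
    qed simp
    also have "\<dots> \<le> u" using \<open>real (n N) / real (n k) \<le> u\<close> by simp
    also have "\<dots> \<le> u powr ?b"
      using powr_mono'[of ?b 1 u] u smoothness by simp
    also have "\<dots> = 1 * 1 * u powr ?b" by simp
    also have "\<dots> \<le> 4 * pi * real (Suc m) powr ?b * u powr ?b"
      using m1 pi by (intro mult_mono mult_right_mono) auto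
    finally show ?thesis using False by simp
  qed
  then show ?thesis
    by (simp add: y_def decay_power u_def)
qed

text \<open>The contribution of \<open>F k\<close> to the difference between the \<open>N\<close>-th partial sum and the smoothed full sum.\<close>

definition truncation_error :: "nat \<Rightarrow> nat \<Rightarrow> real \<Rightarrow> real" where
  "truncation_error N k x = (if k < N then 1 else 0) * F k x - centred_average (1 / real (n N)) (F k) x"

definition error_const :: "nat \<Rightarrow> real" where
  "error_const L = 2 * real L * ((4 * pi)\<^sup>2 * (\<Sum>m. real (Suc m) powr (2 * smoothness - 2 * lam)))"

lemma inverse_n: "0 < 1 / real (n N)" "1 / real (n N) \<le> 1"
  using n_pos[of N] by auto

text \<open>For the partial sums of the sine series the truncation error is a sine polynomial with coefficients
controlled by \<open>multiplier_le\<close>; Fatou's lemma passes to the full series.\<close>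

lemma truncation_error_sqint:
  "sqint_le (sym_interval L) (truncation_error N k) (error_const L * (decay smoothness ^ gap N k)\<^sup>2)"
proof (rule sqint_le_limit_pointwise)
  let ?h = "1 / real (n N)" and ?e = "if k < N then 1 else 0 :: real"
  let ?P = "\<lambda>M x. davenport_partial lam M (real (n k) * x)"
  define c where "c = (\<lambda>m. 1 / real (Suc m) powr lam * (?e - sin (2 * pi * (real (Suc m) * real (n k)) * ?h)
        / (2 * pi * (real (Suc m) * real (n k)) * ?h)))"
  show "(\<lambda>M. ?e * ?P M x - centred_average ?h (?P M) x) \<longlonglongrightarrow> truncation_error N k x"
    if "x \<in> space (sym_interval L)" for x
    unfolding truncation_error_def
  proof (intro tendsto_intros davenport_partial_LIMSEQ)
    show "(\<lambda>M. centred_average ?h (?P M) x) \<longlonglongrightarrow> centred_average ?h (F k) x"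
      by (rule centred_average_LIMSEQ[OF F_sqint sqint_le_davenport_partial[OF lam n_pos]
            sqint_le_davenport_tail[OF lam n_pos] zeta2_tail_LIMSEQ[OF lam]])
        (use that inverse_n in \<open>auto simp: space_restrict_space\<close>)
  qed (use lam in simp)
  show "sqint_le (sym_interval L) (\<lambda>x. ?e * ?P M x - centred_average ?h (?P M) x)
      (error_const L * (decay smoothness ^ gap N k)\<^sup>2)" if "M \<ge> 0" for M
  proof (rule sqint_le_cong[OF sqint_le_mono[OF sqint_le_dilated_sine_polynomial[of "{..<M}" "n k" L c]]])
    show "2 * real L * (\<Sum>m<M. (c m)\<^sup>2) \<le> error_const L * (decay smoothness ^ gap N k)\<^sup>2"
    proof -
      have "(c m)\<^sup>2 \<le> real (Suc m) powr (2 * smoothness - 2 * lam) * ((4 * pi)\<^sup>2 * (decay smoothness ^ gap N k)\<^sup>2)" for m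
      proof -
        have "\<bar>c m\<bar> \<le> 1 / real (Suc m) powr lam * (4 * pi * real (Suc m) powr smoothness * decay smoothness ^ gap N k)"
          unfolding c_def abs_mult using mult_left_mono[OF multiplier_le, of "\<bar>1 / real (Suc m) powr lam\<bar>"] by simp
        also have "\<dots> = real (Suc m) powr (smoothness - lam) * (4 * pi * decay smoothness ^ gap N k)"
          by (simp add: powr_diff mult_ac)
        finally have "(c m)\<^sup>2 \<le> (real (Suc m) powr (smoothness - lam) * (4 * pi * decay smoothness ^ gap N k))\<^sup>2"
          by (rule abs_le_square_iff[THEN iffD1, OF order_trans]) simp
        also have "(real (Suc m) powr (smoothness - lam))\<^sup>2 = real (Suc m) powr (2 * smoothness - 2 * lam)"
          by (simp add: power2_eq_square powr_add[symmetric])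
        then have "(real (Suc m) powr (smoothness - lam) * (4 * pi * decay smoothness ^ gap N k))\<^sup>2
            = real (Suc m) powr (2 * smoothness - 2 * lam) * ((4 * pi)\<^sup>2 * (decay smoothness ^ gap N k)\<^sup>2)"
          by (simp only: power_mult_distrib)
        finally show ?thesis .
      qed
      then have "(\<Sum>m<M. (c m)\<^sup>2) \<le> (\<Sum>m<M. real (Suc m) powr (2 * smoothness - 2 * lam) * ((4 * pi)\<^sup>2 * (decay smoothness ^ gap N k)\<^sup>2))"
        by (rule sum_mono)
      also have "\<dots> = (\<Sum>m<M. real (Suc m) powr (2 * smoothness - 2 * lam)) * ((4 * pi)\<^sup>2 * (decay smoothness ^ gap N k)\<^sup>2)"
        by (simp only: sum_distrib_right)
      also have "\<dots> \<le> (\<Sum>m. real (Suc m) powr (2 * smoothness - 2 * lam)) * ((4 * pi)\<^sup>2 * (decay smoothness ^ gap N k)\<^sup>2)"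
        by (intro mult_right_mono sum_le_suminf summable_powr_Suc smoothness) auto
      finally show ?thesis
        unfolding error_const_def by (simp add: mult_left_mono mult_ac)
    qed
    fix x assume x: "x \<in> space (sym_interval L)"
    then have x': "x \<in> {- real L..real L}" by (simp add: space_restrict_space)
    have sine: "?P M t = (\<Sum>m<M. 1 / real (Suc m) powr lam * sin (2 * pi * real (Suc m * n k) * t))" for t
      by (simp add: davenport_partial_def of_nat_mult mult.assoc del: of_nat_Suc mult_Suc)
    have pos: "Suc m * n k > 0" for m using n_pos[of k] by simp
    then have pos': "real (Suc m * n k) > 0" for m by (simp only: of_nat_0_less_iff)
    have average: "centred_average ?h (\<lambda>t. sin (2 * pi * real (Suc m * n k) * t)) x
        = sin (2 * pi * (real (Suc m) * real (n k)) * ?h) / (2 * pi * (real (Suc m) * real (n k)) * ?h)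
          * sin (2 * pi * real (Suc m) * (real (n k) * x))" for m
      using centred_average_sine[OF inverse_n(1) pos'] by (simp only: of_nat_mult mult.assoc)
    have sum: "centred_average ?h (?P M) x = (\<Sum>m<M. 1 / real (Suc m) powr lam * centred_average ?h (\<lambda>t. sin (2 * pi * real (Suc m * n k) * t)) x)"
      unfolding sine by (rule centred_average_sum[OF sqint_le_sine[OF pos] x' inverse_n])
    have alg: "e * (u / p) - 1 / p * (v * u) = 1 / p * (e - v) * u" for e u v p :: real
      by (simp add: divide_inverse algebra_simps)
    show "?e * ?P M x - centred_average ?h (?P M) x = (\<Sum>m<M. c m * sin (2 * pi * real (Suc m) * (real (n k) * x)))"
      unfolding sum average c_def
      by (simp only: davenport_partial_def sum_distrib_left sum_subtractf[symmetric] alg)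
  qed (use n_pos in auto)
qed

end

context lacunary_davenport
begin

lemma truncation_error_sum_sqint:
  assumes "finite K"
  shows "sqint_le (sym_interval L) (\<lambda>x. \<Sum>k\<in>K. a k * truncation_error N k x)
    (2 / (1 - decay smoothness) * error_const L * (\<Sum>k\<in>K. (a k)\<^sup>2 * decay smoothness ^ gap N k))"
proof -
  let ?r = "decay smoothness"
  have r: "0 < ?r" "?r < 1"
    using decay smoothness(1) by auto
  have E: "error_const L \<ge> 0"
    unfolding error_const_def by (intro mult_nonneg_nonneg suminf_nonneg summable_powr_Suc smoothness) auto
  show ?thesis
  proof (rule sqint_le_mono[OF sqint_le_sum_weighted[where v = "\<lambda>k. ?r ^ gap N k"]])
    show "sqint_le (sym_interval L) (\<lambda>x. a k * truncation_error N k x) ((a k)\<^sup>2 * (error_const L * (?r ^ gap N k)\<^sup>2))" for k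
      by (intro sqint_le_cmult truncation_error_sqint)
    have "(\<Sum>k\<in>K. (a k)\<^sup>2 * (error_const L * (?r ^ gap N k)\<^sup>2) / ?r ^ gap N k)
        = error_const L * (\<Sum>k\<in>K. (a k)\<^sup>2 * ?r ^ gap N k)"
      using r by (simp add: sum_distrib_left power2_eq_square mult_ac)
    moreover have "0 \<le> error_const L * (\<Sum>k\<in>K. (a k)\<^sup>2 * ?r ^ gap N k)"
      using r E by (intro mult_nonneg_nonneg sum_nonneg) auto
    ultimately show "(\<Sum>k\<in>K. ?r ^ gap N k) * (\<Sum>k\<in>K. (a k)\<^sup>2 * (error_const L * (?r ^ gap N k)\<^sup>2) / ?r ^ gap N k)
        \<le> 2 / (1 - ?r) * error_const L * (\<Sum>k\<in>K. (a k)\<^sup>2 * ?r ^ gap N k)"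
      using mult_right_mono[OF sum_power_gap_le[OF r assms]] by (simp only: mult.assoc)
  qed (use r in auto)
qed

lemma smoothed_tail_eq:
  assumes "x \<in> {- real L..real L}" "N \<le> K"
  shows "(\<Sum>k<N. a k * F k x) - centred_average (1 / real (n N)) (\<lambda>t. \<Sum>k<K. a k * F k t) x
    = (\<Sum>k<K. a k * truncation_error N k x)"
proof -
  have "(\<Sum>k<N. a k * F k x) = (\<Sum>k<K. a k * ((if k < N then 1 else 0) * F k x))"
    using assms(2) by (intro sum.mono_neutral_cong_left) auto
  then show ?thesis
    unfolding centred_average_sum[OF F_sqint assms(1) inverse_n] truncation_error_def
    by (simp add: sum_subtractf[symmetric] right_diff_distrib)
qed

text \<open>The differences \<open>T N\<close> between partial sums and averages of the \<open>L\<^sup>2\<close> limit have squared norms bounded by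
\<open>C * b N\<close>, where \<open>b\<close> is a convolution of \<open>(a k)\<^sup>2\<close> with a geometric kernel and is therefore summable.\<close>

lemma AE_convergent_of_square_summable:
  assumes a: "summable (\<lambda>k. (a k)\<^sup>2)"
  shows "AE x in sym_interval L. summable (\<lambda>k. a k * F k x)"
proof -
  let ?M = "sym_interval L" and ?M' = "sym_interval (Suc L)" and ?r = "decay smoothness"
  have r: "0 < ?r" "?r < 1"
    using decay smoothness(1) by auto
  define s where "s = (\<lambda>K x. \<Sum>k<K. a k * F k x)"
  define A where "A = (\<Sum>k. (a k)\<^sup>2)"
  define B where "B = (\<lambda>J. riesz_const (Suc L) * (A - (\<Sum>k<J. (a k)\<^sup>2)))"
  have s_int: "sqint_le ?M' (s K) (riesz_const (Suc L) * (\<Sum>k<K. (a k)\<^sup>2))" for K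
    unfolding s_def by (rule riesz_upper) simp
  have diff: "sqint_le ?M' (\<lambda>x. s K x - s J x) (B J)" if "J \<le> K" for J K
  proof -
    have eq: "s K x - s J x = (\<Sum>k\<in>{J..<K}. a k * F k x)" for x
      using sum_diff_nat_ivl[of 0 J K "\<lambda>k. a k * F k x"] that by (simp add: s_def atLeast0LessThan)
    have "(\<Sum>k\<in>{J..<K}. (a k)\<^sup>2) = (\<Sum>k<K. (a k)\<^sup>2) - (\<Sum>k<J. (a k)\<^sup>2)"
      using sum_diff_nat_ivl[of 0 J K "\<lambda>k. (a k)\<^sup>2"] that by (simp add: atLeast0LessThan)
    also have "\<dots> \<le> A - (\<Sum>k<J. (a k)\<^sup>2)"
      using sum_le_suminf[OF a, of "{..<K}"] by (simp add: A_def)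
    finally show ?thesis
      unfolding eq B_def
      by (intro sqint_le_mono[OF riesz_upper] mult_left_mono riesz_const_nonneg) auto
  qed
  have B0: "B \<longlonglongrightarrow> 0"
  proof -
    have "B \<longlonglongrightarrow> riesz_const (Suc L) * (A - A)"
      unfolding B_def A_def by (intro tendsto_intros summable_LIMSEQ a)
    then show ?thesis by simp
  qed
  obtain S where S: "S \<in> borel_measurable ?M'" "\<And>J. sqint_le ?M' (\<lambda>x. S x - s J x) (B J)"
    using L2_Cauchy_limit[OF finite_measure_sym_interval s_int diff B0] by blast
  have S_int: "sqint_le ?M' S (B 0)"
    using S(2)[of 0] by (simp add: s_def)

  define b where "b = (\<lambda>N. \<Sum>k. (a k)\<^sup>2 * ?r ^ gap N k)"
  define C where "C = 2 / (1 - ?r) * error_const L"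
  have ab: "summable (\<lambda>k. (a k)\<^sup>2 * ?r ^ gap N k)" for N
    by (rule summable_comparison_test'[OF a]) (use r in \<open>auto simp: abs_mult intro!: mult_left_le power_le_one\<close>)
  define T where "T = (\<lambda>N x. s N x - centred_average (1 / real (n N)) S x)"
  have T: "sqint_le ?M (T N) (C * b N)" for N
  proof (rule sqint_le_limit_pointwise[where start = N])
    show "(\<lambda>K. s N x - centred_average (1 / real (n N)) (s K) x) \<longlonglongrightarrow> T N x" if "x \<in> space ?M" for x
      unfolding T_def
      by (intro tendsto_intros centred_average_LIMSEQ[OF S_int s_int S(2) B0])
        (use that inverse_n in \<open>auto simp: space_restrict_space\<close>)
    show "sqint_le ?M (\<lambda>x. s N x - centred_average (1 / real (n N)) (s K) x) (C * b N)" if "K \<ge> N" for K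
    proof (rule sqint_le_cong[OF sqint_le_mono[OF truncation_error_sum_sqint[of "{..<K}" L a N]]])
      have "C \<ge> 0"
        using r unfolding C_def error_const_def
        by (intro mult_nonneg_nonneg suminf_nonneg summable_powr_Suc smoothness) auto
      moreover have "(\<Sum>k<K. (a k)\<^sup>2 * ?r ^ gap N k) \<le> b N"
        unfolding b_def using r by (intro sum_le_suminf ab) auto
      ultimately show "2 / (1 - ?r) * error_const L * (\<Sum>k<K. (a k)\<^sup>2 * ?r ^ gap N k) \<le> C * b N"
        unfolding C_def by (rule mult_left_mono[rotated])
    qed (use that in \<open>auto simp: space_restrict_space s_def intro!: smoothed_tail_eq[of _ L]\<close>)
  qed
  have "summable b"
  proof (rule bounded_imp_summable)
    show "0 \<le> b N" for N
      unfolding b_def using r by (intro suminf_nonneg ab) auto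
    show "(\<Sum>N\<le>P. b N) \<le> (\<Sum>k. (a k)\<^sup>2 * (2 / (1 - ?r)))" for P
    proof -
      have "(\<Sum>N\<le>P. b N) = (\<Sum>k. \<Sum>N\<le>P. (a k)\<^sup>2 * ?r ^ gap N k)"
        unfolding b_def by (rule suminf_sum[symmetric]) (rule ab)
      also have "\<dots> = (\<Sum>k. (a k)\<^sup>2 * (\<Sum>N\<le>P. ?r ^ gap k N))"
        by (simp add: sum_distrib_left gap_commute)
      also have "\<dots> \<le> (\<Sum>k. (a k)\<^sup>2 * (2 / (1 - ?r)))"
      proof (rule suminf_le)
        show le: "(a k)\<^sup>2 * (\<Sum>N\<le>P. ?r ^ gap k N) \<le> (a k)\<^sup>2 * (2 / (1 - ?r))" for k
          by (intro mult_left_mono sum_power_gap_le r) auto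
        show "summable (\<lambda>k. (a k)\<^sup>2 * (2 / (1 - ?r)))"
          by (rule summable_mult2[OF a])
        then show "summable (\<lambda>k. (a k)\<^sup>2 * (\<Sum>N\<le>P. ?r ^ gap k N))"
          by (rule summable_comparison_test'[of _ 0]) (use le r in \<open>simp add: abs_mult sum_nonneg\<close>)
      qed
      finally show ?thesis .
    qed
  qed
  then have "AE x in ?M. (\<lambda>N. T N x) \<longlonglongrightarrow> 0"
    by (intro AE_LIMSEQ_zero_of_summable_sqint[OF T] summable_mult)
  moreover have "AE x in ?M. (\<lambda>N. centred_average (1 / real (n N)) S x) \<longlonglongrightarrow> S x"
  proof -
    (* Differentiation of integrals is applied to the restriction of S to the larger interval;
       near points of the smaller one the restriction does not change the averages. *)
    define S' where "S' = (\<lambda>x. indicator {- real (Suc L)..real (Suc L)} x * S x)"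
    have "integrable ?M' S"
      using sqint_le_Cauchy_Schwarz(1)[OF S_int sqint_le_one[OF finite_measure_sym_interval]] by simp
    then have "integrable lborel S'"
      unfolding S'_def by (simp only: integrable_sym_interval)
    then have ae: "AE x in lborel. ((\<lambda>h. centred_average h S' x) \<longlongrightarrow> S' x) (at_right 0)"
      by (rule centred_average_tendsto)
    have h0: "filterlim (\<lambda>N. 1 / real (n N)) (at_right 0) sequentially"
    proof -
      have "filterlim (\<lambda>N. inverse (real (n N))) (at_right 0) sequentially"
        by (rule filterlim_compose[OF filterlim_inverse_at_right_top filterlim_n])
      then show ?thesis by (simp add: inverse_eq_divide)
    qed
    show ?thesis
      unfolding AE_restrict_space_iff[of "{- real L..real L}" lborel, simplified]
      using ae
    proof eventually_elim
      case (elim x)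
      show ?case
      proof
        assume x: "- real L \<le> x \<and> x \<le> real L"
        have absorb: "indicator A t * (indicator B t * u) = indicator A t * u"
          if "A \<subseteq> B" for A B :: "real set" and t u :: real
          using that by (auto simp: indicator_def)
        have "{x - 1 / real (n N)..x + 1 / real (n N)} \<subseteq> {- real (Suc L)..real (Suc L)}" for N
          using x inverse_n(2)[of N] unfolding atLeastatMost_subset_iff of_nat_Suc by linarith
        then have "centred_average (1 / real (n N)) S' x = centred_average (1 / real (n N)) S x" for N
          unfolding centred_average_def S'_def by (simp only: absorb)
        moreover have "S' x = S x"
          using x by (simp add: S'_def)
        ultimately show "(\<lambda>N. centred_average (1 / real (n N)) S x) \<longlonglongrightarrow> S x"
          using filterlim_compose[OF elim h0] by simp
      qed
    qed
  qed
  ultimately show ?thesis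
  proof eventually_elim
    case (elim x)
    from tendsto_add[OF elim] have "(\<lambda>N. s N x) \<longlonglongrightarrow> S x"
      by (simp add: T_def)
    then show ?case
      by (auto simp: s_def summable_iff_convergent convergent_def)
  qed
qed

end

section \<open>A sifted dual polynomial\<close>

lemma prod_primes_dvd_iff:
  fixes r :: nat
  assumes "finite A" "\<And>p. p \<in> A \<Longrightarrow> prime p"
  shows "\<Prod>A dvd r \<longleftrightarrow> (\<forall>p\<in>A. p dvd r)"
  using assms
proof (induction A rule: finite_induct)
  case (insert p A)
  have "coprime p (\<Prod>A)"
    using insert by (intro prod_coprime_right) (metis insertCI primes_coprime)
  then have "p * \<Prod>A dvd r \<longleftrightarrow> p dvd r \<and> \<Prod>A dvd r"
    by (meson divides_mult dvd_mult_left dvd_mult_right)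
  then show ?case
    using insert by simp
qed simp

text \<open>Legendre's sieve: a product of distinct primes of \<open>P\<close> divides \<open>r\<close> exactly when all of them lie in the set \<open>Q\<close> of
those primes of \<open>P\<close> that divide \<open>r\<close>, and the alternating sum over all subsets of \<open>Q\<close> vanishes unless \<open>Q\<close> is empty.\<close>

lemma sieve_identity:
  fixes r :: nat
  assumes "finite P" "\<And>p. p \<in> P \<Longrightarrow> prime p"
  shows "(\<Sum>A\<in>Pow P. (- 1) ^ card A * (if \<Prod>A dvd r then 1 else 0)) = (if \<forall>p\<in>P. \<not> p dvd r then 1 else 0 :: real)"
proof -
  define Q where "Q = {p \<in> P. p dvd r}"
  have Q: "finite Q" using assms(1) by (simp add: Q_def)
  have "(\<Sum>A\<in>Pow P. (- 1) ^ card A * (if \<Prod>A dvd r then 1 else 0)) = (\<Sum>A\<in>Pow Q. (- 1) ^ card A :: real)"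
  proof (rule sum.mono_neutral_cong_right)
    have iff: "\<Prod>A dvd r \<longleftrightarrow> A \<subseteq> Q" if "A \<subseteq> P" for A
      using prod_primes_dvd_iff[of A r] that assms by (auto simp: Q_def dest: finite_subset)
    show "\<forall>A\<in>Pow P - Pow Q. (- 1) ^ card A * (if \<Prod>A dvd r then 1 else 0) = (0 :: real)"
      using iff by auto
    show "(- 1) ^ card A * (if \<Prod>A dvd r then 1 else 0) = ((- 1) ^ card A :: real)" if "A \<in> Pow Q" for A
      using iff[of A] that by (auto simp: Q_def)
  qed (use assms in \<open>auto simp: Q_def\<close>)
  also have "\<dots> = (\<Prod>p\<in>Q. (1 :: real) - 1)"
    using prod_diff_conv_sum[OF Q, of "\<lambda>_. 1 :: real" "\<lambda>_. 1"] by simp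
  also have "\<dots> = (if Q = {} then 1 else 0)"
    using Q by (auto simp: card_gt_0_iff)
  also have "Q = {} \<longleftrightarrow> (\<forall>p\<in>P. \<not> p dvd r)"
    by (auto simp: Q_def)
  finally show ?thesis .
qed

context lacunary_davenport
begin

text \<open>The adjoint of a truncated inverse. The operator taking the sine of frequency \<open>M\<close> to \<open>f (M * x)\<close> combines the
frequencies \<open>m * M\<close> with weights \<open>m powr (- lam)\<close>; its truncated inverse has weights \<open>\<mu> d * d powr (- lam)\<close>
with \<open>\<mu>\<close> the Moebius function and \<open>d\<close> a product of distinct primes of \<open>P\<close>, and its adjoint divides frequencies by \<open>d\<close>
when possible. Such \<open>d\<close> are encoded by the sets of their prime factors.\<close>

definition dual_polynomial :: "nat set \<Rightarrow> (nat \<Rightarrow> real) \<Rightarrow> nat \<Rightarrow> real \<Rightarrow> real" where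
  "dual_polynomial P a N x = (\<Sum>A\<in>Pow P. (- 1) ^ card A / real (\<Prod>A) powr lam *
     (\<Sum>j | j < N \<and> \<Prod>A dvd n j. a j * sin (2 * pi * real (n j div \<Prod>A) * x)))"

definition sifted_kernel :: "nat set \<Rightarrow> nat \<Rightarrow> nat \<Rightarrow> real" where
  "sifted_kernel P j k = (if n k dvd n j \<and> (\<forall>p\<in>P. \<not> p dvd n j div n k) then (real (n k) / real (n j)) powr lam else 0)"

text \<open>The coefficient of \<open>F k\<close> at frequency \<open>n j / d\<close>, multiplied by \<open>d powr (- lam)\<close>, is \<open>(n k / n j) powr lam\<close>
whatever \<open>d\<close> is. So the sum over \<open>d\<close> only counts, with signs, the \<open>d\<close> dividing \<open>n j / n k\<close>, and the sieve
identity applies.\<close>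

lemma dual_coefficient:
  assumes P: "finite P" "\<And>p. p \<in> P \<Longrightarrow> prime p"
  shows "(\<integral>x. F k x * dual_polynomial P a N x \<partial>sym_interval L) = real L * (\<Sum>j<N. a j * sifted_kernel P j k)"
proof -
  let ?M = "sym_interval L"
  let ?c = "\<lambda>A. (- 1) ^ card A / real (\<Prod>A) powr lam"
  let ?\<nu> = "\<lambda>A j. n j div \<Prod>A"
  have pos: "\<Prod>A > 0" if "A \<in> Pow P" for A
    using that P prime_gt_0_nat by (auto intro!: prod_pos)
  have \<nu>_pos: "?\<nu> A j > 0" if "\<Prod>A dvd n j" for A j
    using that n_pos[of j] by (metis dvd_div_eq_0_iff gr0I less_numeral_extra(3))
  have int: "integrable ?M (\<lambda>x. F k x * sin (2 * pi * real (?\<nu> A j) * x))" if "\<Prod>A dvd n j" for A j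
    by (rule sqint_le_Cauchy_Schwarz(1)[OF F_sqint sqint_le_sine[OF \<nu>_pos[OF that]]])
  have "(\<integral>x. F k x * dual_polynomial P a N x \<partial>?M)
      = (\<integral>x. (\<Sum>A\<in>Pow P. \<Sum>j | j < N \<and> \<Prod>A dvd n j. ?c A * a j * (F k x * sin (2 * pi * real (?\<nu> A j) * x))) \<partial>?M)"
    by (simp add: dual_polynomial_def sum_distrib_left mult_ac)
  also have "\<dots> = (\<Sum>A\<in>Pow P. \<Sum>j | j < N \<and> \<Prod>A dvd n j. ?c A * a j * (\<integral>x. F k x * sin (2 * pi * real (?\<nu> A j) * x) \<partial>?M))"
    by (subst Bochner_Integration.integral_sum,
        (intro Bochner_Integration.integrable_sum integrable_mult_right int; simp),
        intro sum.cong refl, subst Bochner_Integration.integral_sum)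
      (auto intro!: integrable_mult_right int)
  also have "\<dots> = (\<Sum>A\<in>Pow P. \<Sum>j<N. real L * (a j * ((- 1) ^ card A *
      (if \<Prod>A * n k dvd n j then (real (n k) / real (n j)) powr lam else 0))))"
  proof (rule sum.cong[OF refl], rule sum.mono_neutral_cong_left)
    fix A assume A: "A \<in> Pow P"
    show "\<forall>j\<in>{..<N} - {j. j < N \<and> \<Prod>A dvd n j}. real L * (a j * ((- 1) ^ card A *
      (if \<Prod>A * n k dvd n j then (real (n k) / real (n j)) powr lam else 0))) = 0"
      using dvd_mult_left by auto
    fix j assume "j \<in> {j. j < N \<and> \<Prod>A dvd n j}"
    then have d: "\<Prod>A dvd n j" by simp
    have iff: "n k dvd ?\<nu> A j \<longleftrightarrow> \<Prod>A * n k dvd n j"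
      using d pos[OF A] by (metis dvd_div_iff_mult mult.commute less_numeral_extra(3))
    have "real (?\<nu> A j) = real (n j) / real (\<Prod>A)"
      using d by (rule real_of_nat_div)
    then have "(real (n k) / real (?\<nu> A j)) powr lam = real (\<Prod>A) powr lam * (real (n k) / real (n j)) powr lam"
      using pos[OF A] n_pos[of k] n_pos[of j] by (simp add: powr_mult[symmetric] mult.commute)
    then show "?c A * a j * (\<integral>x. F k x * sin (2 * pi * real (?\<nu> A j) * x) \<partial>?M) = real L * (a j * ((- 1) ^ card A *
      (if \<Prod>A * n k dvd n j then (real (n k) / real (n j)) powr lam else 0)))"
      unfolding davenport_sine_coefficient[OF lam n_pos \<nu>_pos[OF d]] iff
      using pos[OF A] by (simp del: of_nat_prod)
  qed auto
  also have "\<dots> = (\<Sum>j<N. real L * (a j * (\<Sum>A\<in>Pow P. (- 1) ^ card A *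
      (if \<Prod>A * n k dvd n j then (real (n k) / real (n j)) powr lam else 0))))"
    by (subst sum.swap) (simp add: sum_distrib_left)
  also have "\<dots> = (\<Sum>j<N. real L * (a j * sifted_kernel P j k))"
  proof (intro sum.cong refl arg_cong[where f = "\<lambda>y. real L * (a _ * y)"])
    fix j
    show "(\<Sum>A\<in>Pow P. (- 1) ^ card A * (if \<Prod>A * n k dvd n j then (real (n k) / real (n j)) powr lam else 0))
      = sifted_kernel P j k"
    proof (cases "n k dvd n j")
      case True
      then have iff: "\<Prod>A * n k dvd n j \<longleftrightarrow> \<Prod>A dvd n j div n k" for A
        using n_pos[of k] by (metis dvd_div_iff_mult less_numeral_extra(3))
      have "(\<Sum>A\<in>Pow P. (- 1) ^ card A * (if \<Prod>A * n k dvd n j then (real (n k) / real (n j)) powr lam else 0))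
          = (\<Sum>A\<in>Pow P. (- 1) ^ card A * (if \<Prod>A dvd n j div n k then 1 else 0)) * (real (n k) / real (n j)) powr lam"
        unfolding sum_distrib_right iff by (intro sum.cong) auto
      also have "\<dots> = sifted_kernel P j k"
        by (subst sieve_identity[OF P]) (use True in \<open>auto simp: sifted_kernel_def\<close>)
      finally show ?thesis .
    next
      case False
      then have "\<not> \<Prod>A * n k dvd n j" for A
        using dvd_mult_right by blast
      then show ?thesis using False by (simp add: sifted_kernel_def)
    qed
  qed
  finally show ?thesis
    by (simp add: sum_distrib_left)
qed

lemma n_less: "j < k \<Longrightarrow> n j < n k"
proof -
  assume "j < k"
  then have "real (n j) * 1 < real (n j) * q ^ gap j k"
    using n_pos[of j] q by (intro mult_strict_left_mono one_less_power) (auto simp: gap_def)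
  also have "\<dots> \<le> real (n k)"
    using growth[of j k] \<open>j < k\<close> by simp
  finally show ?thesis by simp
qed

text \<open>A quotient \<open>r = n j / n k \<noteq> 1\<close> without prime factors up to \<open>D\<close> exceeds \<open>D\<close>. Half of the exponent of
\<open>r powr (- lam)\<close> is spent on smallness in \<open>D\<close>, the other half on decay in \<open>\<bar>j - k\<bar>\<close>.\<close>

lemma sifted_kernel_off_diagonal:
  assumes D: "D > 0" and "j \<noteq> k"
  shows "sifted_kernel {p. prime p \<and> p \<le> D} j k \<le> real D powr (- lam / 2) * decay (lam / 2) ^ gap j k"
proof (cases "n k dvd n j \<and> (\<forall>p\<in>{p. prime p \<and> p \<le> D}. \<not> p dvd n j div n k)")
  case True
  define r where "r = n j div n k"
  have nj: "n j = r * n k" using True by (simp add: r_def)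
  have "r \<noteq> 0" using nj n_pos[of j] by auto
  have "r \<noteq> 1"
    using nj n_less[of j k] n_less[of k j] \<open>j \<noteq> k\<close> by (metis linorder_neqE_nat mult_1 less_irrefl)
  then obtain p where p: "prime p" "p dvd r"
    using prime_factor_nat by blast
  then have "D < p" using True by (auto simp: r_def)
  also have "p \<le> r" using p \<open>r \<noteq> 0\<close> by (simp add: dvd_imp_le)
  finally have "D < r" .
  have "k \<le> j"
  proof (rule ccontr)
    assume "\<not> k \<le> j"
    then have "n j < n k" by (simp add: n_less)
    then show False using nj \<open>r \<noteq> 0\<close> by simp
  qed
  have quot: "real (n k) / real (n j) = 1 / real r"
    using n_pos[of k] by (simp add: nj)
  have "sifted_kernel {p. prime p \<and> p \<le> D} j k = (1 / real r) powr (lam / 2) * (real (n k) / real (n j)) powr (lam / 2)"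
    using True by (simp add: sifted_kernel_def quot powr_add[symmetric])
  also have "\<dots> \<le> (1 / real D) powr (lam / 2) * ((1 / q) ^ gap j k) powr (lam / 2)"
  proof (intro mult_mono powr_mono2)
    show "1 / real r \<le> 1 / real D" using \<open>D < r\<close> D by (simp add: frac_le)
    show "real (n k) / real (n j) \<le> (1 / q) ^ gap j k"
      using quotient_le[OF \<open>k \<le> j\<close>] by (simp add: gap_commute)
  qed (use lam in auto)
  also have "\<dots> = real D powr (- lam / 2) * decay (lam / 2) ^ gap j k"
    by (simp add: decay_power powr_divide powr_minus_divide)
  finally show ?thesis .
next
  case False
  then have "sifted_kernel {p. prime p \<and> p \<le> D} j k = 0"
    by (auto simp: sifted_kernel_def)
  then show ?thesis
    using decay(1)[of "lam / 2"] lam by simp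
qed

lemma sifted_kernel_diagonal:
  assumes "\<And>p. p \<in> P \<Longrightarrow> prime p"
  shows "sifted_kernel P j j = 1"
proof -
  have "1 \<notin> P"
    using assms not_prime_1 by blast
  then show ?thesis
    using n_pos[of j] by (auto simp: sifted_kernel_def)
qed

text \<open>For each divisor \<open>d\<close> the frequencies \<open>n j / d\<close> inherit the lacunarity of \<open>n\<close>, and the number of divisors
depends only on \<open>P\<close>.\<close>

lemma dual_polynomial_on_subset:
  assumes s: "s > 0" "q ^ s \<ge> 2" and P: "finite P" "\<And>p. p \<in> P \<Longrightarrow> prime p" and E: "E \<in> sets (sym_interval L)"
  shows "sqint_le (sym_interval L) (\<lambda>x. indicator E x * dual_polynomial P a N x)
    ((real (card (Pow P)))\<^sup>2 * (real s * sqrt (4 * real L * measure (sym_interval L) E)) * (\<Sum>j<N. (a j)\<^sup>2))"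
proof -
  let ?M = "sym_interval L"
  let ?J = "\<lambda>A. {j. j < N \<and> \<Prod>A dvd n j}"
  let ?K = "real s * sqrt (4 * real L * measure ?M E)"
  let ?h = "\<lambda>A x. \<Sum>j\<in>?J A. a j * sin (2 * pi * real (n j div \<Prod>A) * x)"
  let ?c = "\<lambda>A. (- 1) ^ card A / real (\<Prod>A) powr lam"
  have part: "sqint_le ?M (\<lambda>x. ?c A * (indicator E x * ?h A x)) (?K * (\<Sum>j<N. (a j)\<^sup>2))" if A: "A \<in> Pow P" for A
  proof (rule sqint_le_mono[OF sqint_le_cmult[OF sqint_le_lacunary_on_subset[where s = s]]])
    have d: "\<Prod>A > 0"
      using A P prime_gt_0_nat by (auto intro!: prod_pos)
    fix i j assume ij: "i \<in> ?J A" "j \<in> ?J A" "i + s \<le> j"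
    have "real (n i) * 2 \<le> real (n i) * q ^ s"
      using s by (intro mult_left_mono) auto
    also have "\<dots> \<le> real (n i) * q ^ gap i j"
      using ij(3) q by (intro mult_left_mono power_increasing) (auto simp: gap_def)
    also have "\<dots> \<le> real (n j)"
      using ij(3) by (intro growth) simp
    finally have "n i * 2 \<le> n j" by linarith
    then have "\<Prod>A * (2 * (n i div \<Prod>A)) \<le> \<Prod>A * (n j div \<Prod>A)"
      using ij by (simp add: mult.left_commute)
    then show "2 * (n i div \<Prod>A) \<le> n j div \<Prod>A"
      using d by simp
  next
    fix j assume "j \<in> ?J A"
    then show "n j div \<Prod>A > 0"
      using n_pos[of j] by (metis (mono_tags, lifting) dvd_div_eq_0_iff gr0I less_numeral_extra(3) mem_Collect_eq)
  next
    have d: "\<Prod>A > 0"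
      using A P prime_gt_0_nat by (auto intro!: prod_pos)
    have "1 \<le> real (\<Prod>A) powr lam"
      using d lam by (intro ge_one_powr_ge_zero) (auto simp del: of_nat_prod)
    then have "1 / real (\<Prod>A) powr lam \<le> 1"
      using d by (simp add: divide_le_eq_1 del: of_nat_prod)
    then have "\<bar>?c A\<bar> \<le> 1"
      by (simp add: abs_divide power_abs del: of_nat_prod)
    then have "(?c A)\<^sup>2 \<le> 1"
      by (simp add: abs_square_le_1)
    moreover have "(\<Sum>j\<in>?J A. (a j)\<^sup>2) \<le> (\<Sum>j<N. (a j)\<^sup>2)"
      by (intro sum_mono2) auto
    ultimately have "(?c A)\<^sup>2 * (?K * (\<Sum>j\<in>?J A. (a j)\<^sup>2)) \<le> 1 * (?K * (\<Sum>j<N. (a j)\<^sup>2))"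
      by (intro mult_mono mult_nonneg_nonneg sum_nonneg) auto
    then show "(?c A)\<^sup>2 * (?K * (\<Sum>j\<in>?J A. (a j)\<^sup>2)) \<le> ?K * (\<Sum>j<N. (a j)\<^sup>2)" by simp
  qed (use s E in auto)
  have "sqint_le ?M (\<lambda>x. \<Sum>A\<in>Pow P. ?c A * (indicator E x * ?h A x))
      (real (card (Pow P)) * (\<Sum>A\<in>Pow P. ?K * (\<Sum>j<N. (a j)\<^sup>2)))"
    by (rule sqint_le_sum) (rule part)
  also have "(\<lambda>x. \<Sum>A\<in>Pow P. ?c A * (indicator E x * ?h A x)) = (\<lambda>x. indicator E x * dual_polynomial P a N x)"
    by (simp only: dual_polynomial_def sum_distrib_left mult.left_commute)
  finally show ?thesis
    by (simp add: power2_eq_square mult_ac)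
qed

text \<open>\<open>D\<close> is chosen so large that, by Schur's test, the off-diagonal part of the sifted kernel is at most half of
the diagonal.\<close>

lemma exists_dual_primes:
  "\<exists>P. finite P \<and> (\<forall>p\<in>P. prime p) \<and> (\<forall>a N L. real L / 2 * (\<Sum>k<N. (a k)\<^sup>2) \<le> (\<integral>x. (\<Sum>k<N. a k * F k x) * dual_polynomial P a N x \<partial>sym_interval L))"
proof -
  let ?r = "decay (lam / 2)"
  have r: "0 < ?r" "?r < 1"
    using decay[of "lam / 2"] lam by auto
  have "(\<lambda>D. real D powr (- lam / 2) * (2 / (1 - ?r))) \<longlonglongrightarrow> 0 * (2 / (1 - ?r))"
    using lam by (intro tendsto_mult_right tendsto_neg_powr filterlim_real_sequentially) auto
  then have "\<forall>\<^sub>F D in sequentially. real D powr (- lam / 2) * (2 / (1 - ?r)) < 1 / 2"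
    by (intro order_tendstoD) auto
  then have "\<forall>\<^sub>F D in sequentially. D > 0 \<and> real D powr (- lam / 2) * (2 / (1 - ?r)) < 1 / 2"
    using eventually_gt_at_top[of 0] by eventually_elim auto
  then obtain D where D: "D > 0" "real D powr (- lam / 2) * (2 / (1 - ?r)) < 1 / 2"
    using eventually_happens'[OF sequentially_bot] by blast
  let ?e = "real D powr (- lam / 2)"
  define P where "P = {p :: nat. prime p \<and> p \<le> D}"
  have P: "finite P" "\<And>p. p \<in> P \<Longrightarrow> prime p"
    by (auto simp: P_def)
  have "real L / 2 * (\<Sum>k<N. (a k)\<^sup>2) \<le> (\<integral>x. (\<Sum>k<N. a k * F k x) * dual_polynomial P a N x \<partial>sym_interval L)" for a N L
  proof -
    let ?M = "sym_interval L"
    obtain s where "q ^ s > 2" using real_arch_pow[OF q] by blast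
    moreover from this have "s > 0" by (cases s) auto
    ultimately have "sqint_le ?M (\<lambda>x. indicator (space ?M) x * dual_polynomial P a N x)
        ((real (card (Pow P)))\<^sup>2 * (real s * sqrt (4 * real L * measure ?M (space ?M))) * (\<Sum>j<N. (a j)\<^sup>2))"
      by (intro dual_polynomial_on_subset P sets.top) auto
    then have G: "sqint_le ?M (dual_polynomial P a N)
        ((real (card (Pow P)))\<^sup>2 * (real s * sqrt (4 * real L * measure ?M (space ?M))) * (\<Sum>j<N. (a j)\<^sup>2))"
      by (rule sqint_le_cong) simp
    have "(\<integral>x. (\<Sum>k<N. a k * F k x) * dual_polynomial P a N x \<partial>?M)
        = (\<integral>x. (\<Sum>k<N. a k * (F k x * dual_polynomial P a N x)) \<partial>?M)"
      by (simp add: sum_distrib_right mult.assoc)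
    also have "\<dots> = (\<Sum>k<N. a k * (real L * (\<Sum>j<N. a j * sifted_kernel P j k)))"
      using sqint_le_Cauchy_Schwarz(1)[OF F_sqint G] by (simp add: dual_coefficient[OF P])
    also have "\<dots> = real L * (\<Sum>k<N. \<Sum>j<N. a k * a j * sifted_kernel P j k)"
      by (simp add: sum_distrib_left mult_ac)
    also have "\<dots> \<ge> real L * (1 / 2 * (\<Sum>k<N. (a k)\<^sup>2))"
    proof (rule mult_left_mono)
      have "(\<Sum>k<N. (a k)\<^sup>2) - ?e * (\<Sum>k<N. \<Sum>j<N. \<bar>a k\<bar> * \<bar>a j\<bar> * ?r ^ gap k j)
          = (\<Sum>k<N. \<Sum>j<N. (if k = j then (a k)\<^sup>2 else 0) - ?e * (\<bar>a k\<bar> * \<bar>a j\<bar> * ?r ^ gap k j))"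
        by (simp add: sum_subtractf sum_distrib_left)
      also have "\<dots> \<le> (\<Sum>k<N. \<Sum>j<N. a k * a j * sifted_kernel P j k)"
      proof (intro sum_mono)
        fix k j
        have nn: "0 \<le> ?e * (\<bar>a k\<bar> * \<bar>a j\<bar> * ?r ^ gap k j)" using r by simp
        show "(if k = j then (a k)\<^sup>2 else 0) - ?e * (\<bar>a k\<bar> * \<bar>a j\<bar> * ?r ^ gap k j) \<le> a k * a j * sifted_kernel P j k"
        proof (cases "k = j")
          case True
          then show ?thesis using nn sifted_kernel_diagonal[of P, OF P(2)] by (simp add: power2_eq_square)
        next
          case False
          have "- (a k * a j * sifted_kernel P j k) \<le> \<bar>a k * a j * sifted_kernel P j k\<bar>"
            by simp
          also have "\<dots> = \<bar>a k\<bar> * \<bar>a j\<bar> * sifted_kernel P j k"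
            by (simp add: abs_mult sifted_kernel_def)
          also have "\<dots> \<le> \<bar>a k\<bar> * \<bar>a j\<bar> * (?e * ?r ^ gap k j)"
            using sifted_kernel_off_diagonal[OF D(1), of j k] False
            by (intro mult_left_mono) (auto simp: P_def gap_commute)
          finally show ?thesis using False by (simp add: mult_ac)
        qed
      qed
      finally have "(\<Sum>k<N. (a k)\<^sup>2) - ?e * (\<Sum>k<N. \<Sum>j<N. \<bar>a k\<bar> * \<bar>a j\<bar> * ?r ^ gap k j)
          \<le> (\<Sum>k<N. \<Sum>j<N. a k * a j * sifted_kernel P j k)" .
      moreover have "?e * (\<Sum>k<N. \<Sum>j<N. \<bar>a k\<bar> * \<bar>a j\<bar> * ?r ^ gap k j) \<le> ?e * (2 / (1 - ?r) * (\<Sum>k<N. (a k)\<^sup>2))"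
        by (intro mult_left_mono schur_gap r) auto
      moreover have "(?e * (2 / (1 - ?r))) * (\<Sum>k<N. (a k)\<^sup>2) \<le> 1 / 2 * (\<Sum>k<N. (a k)\<^sup>2)"
        using D(2) by (intro mult_right_mono sum_nonneg) auto
      ultimately show "1 / 2 * (\<Sum>k<N. (a k)\<^sup>2) \<le> (\<Sum>k<N. \<Sum>j<N. a k * a j * sifted_kernel P j k)"
        by (simp only: mult.assoc)
    qed simp
    finally show ?thesis by simp
  qed
  with P show ?thesis by blast
qed

section \<open>Almost everywhere convergence implies square summability\<close>

text \<open>Here \<open>U m\<close> is the set where some partial sum exceeds \<open>m\<close>. Its measure tends to \<open>0\<close>, and \<open>m\<close> is chosen so that the
integral over \<open>U m\<close> is at most a quarter of \<open>\<alpha> N\<close>, for all \<open>N\<close> at once. The rest grows only like the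
square root of \<open>\<alpha> N\<close>, which bounds \<open>\<alpha> N\<close>.\<close>

lemma square_summable_of_AE_convergent:
  assumes ae: "AE x in sym_interval 1. summable (\<lambda>k. a k * F k x)"
  shows "summable (\<lambda>k. (a k)\<^sup>2)"
proof -
  let ?M = "sym_interval 1"
  interpret finite_measure ?M by (rule finite_measure_sym_interval)
  define s where "s = (\<lambda>N x. \<Sum>k<N. a k * F k x)"
  define \<alpha> where "\<alpha> = (\<lambda>N. \<Sum>k<N. (a k)\<^sup>2)"
  obtain P where P: "finite P" "\<And>p. p \<in> P \<Longrightarrow> prime p"
    and dual: "\<And>a N L. real L / 2 * (\<Sum>k<N. (a k)\<^sup>2) \<le> (\<integral>x. (\<Sum>k<N. a k * F k x) * dual_polynomial P a N x \<partial>sym_interval L)"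
    using exists_dual_primes by blast
  obtain t where "q ^ t > 2" using real_arch_pow[OF q] by blast
  then have t: "t > 0" "q ^ t \<ge> 2" by (auto intro: Nat.gr0I)
  (* The factor 2 is the square root of 4 L for L = 1. *)
  define C where "C = (real (card (Pow P)))\<^sup>2 * real t * 2"
  have G: "sqint_le ?M (\<lambda>x. indicator E x * dual_polynomial P a N x) (C * sqrt (measure ?M E) * \<alpha> N)" if "E \<in> sets ?M" for E N
    using dual_polynomial_on_subset[OF t P that, of a N] by (simp add: C_def \<alpha>_def real_sqrt_mult mult_ac)
  have s_meas [measurable]: "s N \<in> borel_measurable ?M" for N
    unfolding s_def by (intro borel_measurable_sum borel_measurable_times borel_measurable_const sqint_le_measurable[OF F_sqint])
  have s_int: "sqint_le ?M (s N) (riesz_const 1 * \<alpha> N)" for N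
    unfolding s_def \<alpha>_def by (rule riesz_upper) simp
  have C0: "C \<ge> 0" by (simp add: C_def)
  have \<alpha>0: "\<alpha> N \<ge> 0" for N by (simp add: \<alpha>_def sum_nonneg)

  define U where "U = (\<lambda>m. {x \<in> space ?M. \<exists>N. \<bar>s N x\<bar> > real m})"
  have U: "U m \<in> sets ?M" for m
    unfolding U_def by measurable
  have "U (Suc m) \<subseteq> U m" for m
  proof
    fix x assume "x \<in> U (Suc m)"
    then obtain N where "x \<in> space ?M" "\<bar>s N x\<bar> > real (Suc m)"
      unfolding U_def by blast
    moreover from this have "\<bar>s N x\<bar> > real m" by simp
    ultimately show "x \<in> U m"
      unfolding U_def by blast
  qed
  then have "decseq U"
    by (rule decseq_SucI)
  then have "(\<lambda>m. measure ?M (U m)) \<longlonglongrightarrow> measure ?M (\<Inter>m. U m)"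
    using U by (intro finite_Lim_measure_decseq) auto
  moreover have "measure ?M (\<Inter>m. U m) = 0"
  proof -
    have "AE x in ?M. x \<notin> (\<Inter>m. U m)"
      using ae
    proof eventually_elim
      case (elim x)
      then have "convergent (\<lambda>N. s N x)"
        by (simp add: s_def summable_iff_convergent)
      then obtain B where B: "\<And>N. \<bar>s N x\<bar> \<le> B"
        using convergent_imp_Bseq BseqE by (metis real_norm_def)
      obtain m where "B \<le> real m" using real_arch_simple by blast
      then have "x \<notin> U m"
        using B by (auto simp: U_def not_less intro: order_trans)
      then show ?case by blast
    qed
    then have "emeasure ?M {x \<in> space ?M. x \<in> (\<Inter>m. U m)} = 0"
      by (rule emeasure_eq_0_AE)
    also have "{x \<in> space ?M. x \<in> (\<Inter>m. U m)} = (\<Inter>m. U m)"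
      unfolding U_def by blast
    finally have "emeasure ?M (\<Inter>m. U m) = 0" .
    then show ?thesis by (simp add: measure_def)
  qed
  ultimately have "(\<lambda>m. sqrt (riesz_const 1 * (C * sqrt (measure ?M (U m))))) \<longlonglongrightarrow> sqrt (riesz_const 1 * (C * sqrt 0))"
    by (intro tendsto_intros) simp
  then have "\<forall>\<^sub>F m in sequentially. sqrt (riesz_const 1 * (C * sqrt (measure ?M (U m)))) < 1 / 4"
    by (intro order_tendstoD) auto
  then obtain m where m: "sqrt (riesz_const 1 * (C * sqrt (measure ?M (U m)))) < 1 / 4"
    using eventually_happens'[OF sequentially_bot] by blast

  let ?B = "16 * (2 * (real m)\<^sup>2 * (C * sqrt 2))"
  have "\<alpha> N \<le> ?B" for N
  proof -
    let ?G = "dual_polynomial P a N" and ?E = "space ?M - U m"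
    have GM: "sqint_le ?M ?G (C * sqrt 2 * \<alpha> N)"
      using G[OF sets.top, of N] by (rule sqint_le_cong[OF sqint_le_mono]) (simp_all add: measure_restrict_space space_restrict_space)
    have "sqint_le ?M (\<lambda>x. real m) ((real m)\<^sup>2 * 2)"
      using sqint_le_cmult[OF sqint_le_one[OF finite_measure_axioms], of "real m"] measure_sym_interval[of 1] by simp
    then have sE: "sqint_le ?M (\<lambda>x. indicator ?E x * s N x) ((real m)\<^sup>2 * 2)"
    proof (rule sqint_le_bound)
      show "(\<lambda>x. indicator ?E x * s N x) \<in> borel_measurable ?M"
        by (intro borel_measurable_times borel_measurable_indicator s_meas sets.compl_sets U)
    qed (auto simp: indicator_def U_def not_less)
    have "1 / 2 * \<alpha> N \<le> (\<integral>x. s N x * ?G x \<partial>?M)"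
      using dual[where L = 1 and N = N and a = a] by (simp add: s_def \<alpha>_def)
    also have "\<dots> = (\<integral>x. indicator ?E x * s N x * ?G x + s N x * (indicator (U m) x * ?G x) \<partial>?M)"
      by (intro Bochner_Integration.integral_cong) (auto simp: indicator_def)
    also have "\<dots> = (\<integral>x. indicator ?E x * s N x * ?G x \<partial>?M) + (\<integral>x. s N x * (indicator (U m) x * ?G x) \<partial>?M)"
      by (intro Bochner_Integration.integral_add sqint_le_Cauchy_Schwarz(1)[OF sE GM] sqint_le_Cauchy_Schwarz(1)[OF s_int G[OF U]])
    also have "\<dots> \<le> sqrt ((real m)\<^sup>2 * 2 * (C * sqrt 2 * \<alpha> N)) + sqrt (riesz_const 1 * \<alpha> N * (C * sqrt (measure ?M (U m)) * \<alpha> N))"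
      using sqint_le_Cauchy_Schwarz(3)[OF sE GM] sqint_le_Cauchy_Schwarz(3)[OF s_int G[OF U], of N m N] by linarith
    also have "riesz_const 1 * \<alpha> N * (C * sqrt (measure ?M (U m)) * \<alpha> N) = riesz_const 1 * (C * sqrt (measure ?M (U m))) * (\<alpha> N)\<^sup>2"
      by (simp add: power2_eq_square mult_ac)
    also have "sqrt \<dots> = sqrt (riesz_const 1 * (C * sqrt (measure ?M (U m)))) * \<alpha> N"
      using \<alpha>0 by (simp add: real_sqrt_mult)
    also have "\<dots> \<le> 1 / 4 * \<alpha> N"
      using m \<alpha>0 by (intro mult_right_mono) auto
    finally have "\<alpha> N / 4 \<le> sqrt ((real m)\<^sup>2 * 2 * (C * sqrt 2 * \<alpha> N))"
      by simp
    then have "(\<alpha> N / 4)\<^sup>2 \<le> (real m)\<^sup>2 * 2 * (C * sqrt 2 * \<alpha> N)"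
      using \<alpha>0[of N] by (intro sqrt_ge_absD) simp
    then have "\<alpha> N * \<alpha> N \<le> ?B * \<alpha> N"
      by (simp add: power2_eq_square mult_ac)
    moreover have "?B \<ge> 0" using C0 by simp
    ultimately show ?thesis
      using \<alpha>0[of N] by (cases "\<alpha> N = 0") (auto dest: mult_right_le_imp_le)
  qed
  then have "(\<Sum>k\<le>N. (a k)\<^sup>2) \<le> ?B" for N
    unfolding \<alpha>_def lessThan_Suc_atMost[symmetric] .
  then show ?thesis
    by (rule bounded_imp_summable[rotated]) simp
qed

end

theorem theoremD:
  fixes lam :: real and n :: "nat \<Rightarrow> nat" and a :: "nat \<Rightarrow> complex"
  assumes "lam > 1 / 2"
    and "\<And>k. n k > 0"
    and "hadamard_lacunary n"
  shows "(AE x in lebesgue. summable (\<lambda>k. a k * complex_of_real (davenport lam (real (n k) * x))))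
    \<longleftrightarrow> summable (\<lambda>k. (cmod (a k))\<^sup>2)"
proof -
  obtain q where "q > 1" "\<And>k. real (n (Suc k)) / real (n k) \<ge> q"
    using assms(3) by (auto simp: hadamard_lacunary_iff)
  then interpret lacunary_davenport lam n q
    using assms by unfold_locales auto
  have split: "summable (\<lambda>k. a k * complex_of_real (F k x))
      \<longleftrightarrow> summable (\<lambda>k. Re (a k) * F k x) \<and> summable (\<lambda>k. Im (a k) * F k x)" for x
    by (simp add: summable_complex_iff)
  show ?thesis
  proof
    assume "AE x in lebesgue. summable (\<lambda>k. a k * complex_of_real (F k x))"
    then have "AE x in lborel. summable (\<lambda>k. a k * complex_of_real (F k x))"
      by (simp add: AE_completion_iff)
    then have "AE x in sym_interval 1. summable (\<lambda>k. a k * complex_of_real (F k x))"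
      by (subst AE_restrict_space_iff) auto
    then have "AE x in sym_interval 1. summable (\<lambda>k. Re (a k) * F k x)" "AE x in sym_interval 1. summable (\<lambda>k. Im (a k) * F k x)"
      unfolding split by auto
    then have "summable (\<lambda>k. (Re (a k))\<^sup>2 + (Im (a k))\<^sup>2)"
      by (intro summable_add square_summable_of_AE_convergent)
    then show "summable (\<lambda>k. (cmod (a k))\<^sup>2)"
      by (simp add: cmod_power2)
  next
    assume sum: "summable (\<lambda>k. (cmod (a k))\<^sup>2)"
    have "summable (\<lambda>k. (Re (a k))\<^sup>2)" "summable (\<lambda>k. (Im (a k))\<^sup>2)"
      by (rule summable_comparison_test'[OF sum, of 0]; simp add: cmod_power2)+
    then have "AE x in sym_interval L. summable (\<lambda>k. a k * complex_of_real (F k x))" for L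
      unfolding split using AE_convergent_of_square_summable[of "\<lambda>k. Re (a k)" L]
        AE_convergent_of_square_summable[of "\<lambda>k. Im (a k)" L] by auto
    then have "AE x in lborel. x \<in> {- real L..real L} \<longrightarrow> summable (\<lambda>k. a k * complex_of_real (F k x))" for L
      by (subst (asm) AE_restrict_space_iff) auto
    then have "AE x in lborel. \<forall>L. x \<in> {- real L..real L} \<longrightarrow> summable (\<lambda>k. a k * complex_of_real (F k x))"
      by (intro AE_all_countable[THEN iffD2] allI)
    then have "AE x in lborel. summable (\<lambda>k. a k * complex_of_real (F k x))"
    proof eventually_elim
      case (elim x)
      obtain L where "\<bar>x\<bar> \<le> real L" using real_arch_simple by blast
      then have "x \<in> {- real L..real L}" by auto
      with elim show ?case by blast
    qed
    then show "AE x in lebesgue. summable (\<lambda>k. a k * complex_of_real (F k x))"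
      by (rule AE_completion)
  qed
qed

end
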